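(* There is a universal constant $C<\infty$ such that the following holds. Let $d\ge1$ be an integer, $\alpha\in(0,1]$, $\gamma>0$, $A>d$. Let $\phi\in C^\alpha(\mathbb{T}^d)$ be real valued, and let $\boldsymbol{\omega}\in\mathbb{T}^d$ satisfy the Diophantine condition $$\|\boldsymbol{k}\cdot\boldsymbol{\omega}\|\ \ge\ \frac{\gamma}{|\boldsymbol{k}|^A}\qquad\text{for all }\boldsymbol{k}\in\mathbb{Z}^d\setminus\{0\}.$$ Let $\phi^{(N)}$ be the $N$-th Birkhoff sum of $\phi$ over the translation $T_{\boldsymbol{\omega}}:\mathbb{T}^d\to\mathbb{T}^d$, $T_{\boldsymbol{\omega}}\boldsymbol{x}=\boldsymbol{x}+\boldsymbol{\omega}$. Then for all $N\ge1$, $$\left\|\frac1N\,\phi^{(N)}-\int_{\mathbb{T}^d}\phi\right\|_\infty\ \le\ \frac{C}{\gamma}\,\|\phi\|_\alpha\,\frac{1}{N^\beta},\qquad \beta=\frac{\alpha}{A+d}.$$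
   Context: $\mathbb{T}^d=(\mathbb{R}/\mathbb{Z})^d$ is endowed with Haar probability measure. For $t\in\mathbb{R}$, $\|t\|:=\operatorname{dist}(t,\mathbb{Z})$. For $\boldsymbol{k}=(k_1,\ldots,k_d)\in\mathbb{Z}^d$, $|\boldsymbol{k}|:=\max_j|k_j|$ and $\boldsymbol{k}\cdot\boldsymbol{x}:=k_1x_1+\cdots+k_dx_d$. The distance on $\mathbb{T}^d$ is $d(\boldsymbol{x},\boldsymbol{y})=\max_{1\le j\le d}\|x_j-y_j\|$. $\phi^{(N)}(\boldsymbol{x}):=\sum_{j=0}^{N-1}\phi(\boldsymbol{x}+j\boldsymbol{\omega})$. $C^\alpha(\mathbb{T}^d)$ is the space of $\alpha$-Hölder continuous functions with norm $\|\phi\|_\alpha:=\|\phi\|_\infty+\sup_{\boldsymbol{x}\ne\boldsymbol{y}}\frac{|\phi(\boldsymbol{x})-\phi(\boldsymbol{y})|}{d(\boldsymbol{x},\boldsymbol{y})^\alpha}$. $\|\cdot\|_\infty$ is the sup norm. "Universal constant" means one independent of all the parameters $d,\alpha,\gamma,A,\phi,\boldsymbol{\omega},N$. *)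

theory Defs
  imports "HOL-Probability.Probability"
begin

section \<open>The circle group\<close>

quotient_type circle = real / "\<lambda>x y::real. x - y \<in> \<int>"
  morphisms rep_circle to_circle
proof (rule equivpI)
  show "reflp (\<lambda>x y::real. x - y \<in> \<int>)"
    by (simp add: reflp_def)
  show "symp (\<lambda>x y::real. x - y \<in> \<int>)"
  proof (rule sympI)
    fix x y :: real
    assume "x - y \<in> \<int>"
    from Ints_minus[OF this] show "y - x \<in> \<int>" by simp
  qed
  show "transp (\<lambda>x y::real. x - y \<in> \<int>)"
  proof (rule transpI)
    fix x y z :: real
    assume "x - y \<in> \<int>" "y - z \<in> \<int>"
    from Ints_add[OF this] show "x - z \<in> \<int>" by simp
  qed
qed

instantiation circle :: ab_group_add
begin

lift_definition zero_circle :: circle is "0 :: real" .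

lift_definition plus_circle :: "circle \<Rightarrow> circle \<Rightarrow> circle" is "(+) :: real \<Rightarrow> real \<Rightarrow> real"
  by (metis Ints_add add_diff_add)

lift_definition uminus_circle :: "circle \<Rightarrow> circle" is "uminus :: real \<Rightarrow> real"
  by (metis Ints_minus minus_diff_minus)

lift_definition minus_circle :: "circle \<Rightarrow> circle \<Rightarrow> circle" is "(-) :: real \<Rightarrow> real \<Rightarrow> real"
  by (metis Ints_diff diff_diff_eq2 diff_add_eq add_diff_eq)

instance
  by standard (transfer; simp)+

end

lift_definition circle_scale :: "int \<Rightarrow> circle \<Rightarrow> circle" is "\<lambda>k t. of_int k * t"
  by (metis Ints_mult Ints_of_int right_diff_distrib)

lemma infdist_Ints_attained:
  fixes t :: real
  obtains z where "z \<in> \<int>" "infdist t \<int> = dist t z"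
proof -
  have "(\<int> :: real set) \<noteq> {}" using Ints_0 by blast
  with that show ?thesis
    using infdist_attains_inf[OF closed_Ints, of t] by metis
qed

lemma infdist_Ints_shift:
  fixes s t :: real
  assumes "s - t \<in> \<int>"
  shows "infdist s \<int> = infdist t \<int>"
proof -
  have le: "infdist s \<int> \<le> infdist t \<int>" if st: "s - t \<in> \<int>" for s t :: real
  proof -
    obtain z where z: "z \<in> \<int>" "infdist t \<int> = dist t z"
      by (rule infdist_Ints_attained)
    have "(s - t) + z \<in> \<int>" using st z(1) by simp
    moreover have "dist s ((s - t) + z) = dist t z" by (simp add: dist_real_def)
    ultimately show ?thesis using infdist_le[of "(s - t) + z" "\<int>" s] z(2) by simp
  qed
  have "t - s \<in> \<int>" using assms by (metis Ints_minus minus_diff_eq)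
  with assms le[of s t] le[of t s] show ?thesis by simp
qed

lift_definition circle_norm :: "circle \<Rightarrow> real" is "\<lambda>t. infdist t \<int>"
  by (rule infdist_Ints_shift)

lemma circle_norm_to_circle: "circle_norm (to_circle t) = \<bar>t - of_int (round t)\<bar>"
proof (transfer, rule antisym)
  fix t :: real
  show "infdist t \<int> \<le> \<bar>t - of_int (round t)\<bar>"
    using infdist_le[of "of_int (round t)" "\<int> :: real set" t] by (simp add: dist_real_def)
  obtain z where z: "z \<in> \<int>" "infdist t \<int> = dist t z"
    by (rule infdist_Ints_attained)
  then obtain m where m: "z = of_int m" by (auto elim: Ints_cases)
  show "\<bar>t - of_int (round t)\<bar> \<le> infdist t \<int>"
    using round_diff_minimal[of t m] z(2) m by (simp add: dist_real_def)
qed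

lemma circle_norm_eq_0_iff: "circle_norm x = 0 \<longleftrightarrow> x = 0"
proof transfer
  fix x :: real
  have "(\<int> :: real set) \<noteq> {}" using Ints_0 by blast
  then show "infdist x \<int> = 0 \<longleftrightarrow> x - 0 \<in> \<int>"
    using in_closed_iff_infdist_zero[OF closed_Ints, of x] by simp
qed

lemma circle_norm_diff_le: "circle_norm (x - y) \<le> circle_norm x + circle_norm y"
proof transfer
  fix x y :: real
  obtain z where z: "z \<in> \<int>" "infdist x \<int> = dist x z"
    by (rule infdist_Ints_attained)
  obtain w where w: "w \<in> \<int>" "infdist y \<int> = dist y w"
    by (rule infdist_Ints_attained)
  have "infdist (x - y) \<int> \<le> dist (x - y) (z - w)"
    using z(1) w(1) by (intro infdist_le) auto
  also have "\<dots> \<le> dist x z + dist y w" by (simp add: dist_real_def)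
  finally show "infdist (x - y) \<int> \<le> infdist x \<int> + infdist y \<int>" using z w by simp
qed

instantiation circle :: metric_space
begin

definition dist_circle :: "circle \<Rightarrow> circle \<Rightarrow> real" where
  "dist_circle x y = circle_norm (x - y)"

definition uniformity_circle :: "(circle \<times> circle) filter" where
  "uniformity_circle = (INF e\<in>{0 <..}. principal {(x, y). dist x y < e})"

definition open_circle :: "circle set \<Rightarrow> bool" where
  "open_circle U \<longleftrightarrow> (\<forall>x\<in>U. \<forall>\<^sub>F (x', y) in uniformity. x' = x \<longrightarrow> y \<in> U)"

instance
proof
  fix x y z :: circle
  show "dist x y = 0 \<longleftrightarrow> x = y"
    by (simp add: dist_circle_def circle_norm_eq_0_iff)
  show "dist x y \<le> dist x z + dist y z"
    using circle_norm_diff_le[of "x - z" "y - z"] by (simp add: dist_circle_def)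
qed (simp_all add: uniformity_circle_def open_circle_def)

end

lemma continuous_to_circle: "continuous_on S to_circle"
proof -
  have le: "dist (to_circle s) (to_circle t) \<le> dist s t" for s t
    unfolding dist_circle_def
    by transfer (metis Ints_0 dist_real_def diff_zero infdist_le)
  show ?thesis
    by (rule continuous_onI) (metis le le_less_trans less_imp_le)
qed

lemma measurable_to_circle [measurable]: "to_circle \<in> borel_measurable borel"
  by (intro borel_measurable_continuous_onI continuous_to_circle)

text \<open>Normalized Haar measure on the circle; see \<open>prob_space_circle_haar\<close> and
  \<open>circle_haar_translation_invariant\<close> below.\<close>

definition circle_haar :: "circle measure" where
  "circle_haar = distr (restrict_space lborel {0..<1}) borel to_circle"

lemma space_circle_haar [simp]: "space circle_haar = UNIV"
  by (simp add: circle_haar_def)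

lemma sets_circle_haar [simp, measurable_cong]: "sets circle_haar = sets borel"
  by (simp add: circle_haar_def)

lemma measurable_to_circle_restrict:
  "to_circle \<in> measurable (restrict_space lborel {0..<1}) borel"
  by (intro measurable_restrict_space1) simp

lemma emeasure_circle_haar:
  assumes "B \<in> sets borel"
  shows "emeasure circle_haar B = emeasure lborel (to_circle -` B \<inter> {0..<1})"
  using assms unfolding circle_haar_def
  by (subst emeasure_distr[OF measurable_to_circle_restrict])
     (auto simp: emeasure_restrict_space space_restrict_space Int_commute)

lemma prob_space_circle_haar: "prob_space circle_haar"
  by (rule prob_spaceI) (simp add: emeasure_circle_haar)

lemma to_circle_add: "to_circle (s + t) = to_circle s + to_circle t"
  by transfer simp

lemma to_circle_of_int_add: "to_circle (s + of_int k) = to_circle s"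
  by transfer simp

lemma circle_haar_translation_invariant:
  "distr circle_haar circle_haar (\<lambda>x. x + c) = circle_haar"
proof (rule measure_eqI)
  show "sets (distr circle_haar circle_haar (\<lambda>x. x + c)) = sets circle_haar" by simp
next
  fix B assume "B \<in> sets (distr circle_haar circle_haar (\<lambda>x. x + c))"
  then have B: "B \<in> sets borel" by simp
  obtain r where r: "c = to_circle r"
    by (metis Quotient_circle Quotient_abs_rep)
  define a where "a = frac r"
  have a: "0 \<le> a" "a < 1" by (simp_all add: a_def frac_lt_1)
  have ca: "c = to_circle a"
    using to_circle_of_int_add[of a "\<lfloor>r\<rfloor>"] r by (simp add: a_def frac_def)
  have "dist (x + c) (y + c) = dist x y" for x y :: circle
    by (simp add: dist_circle_def)
  then have "continuous_on UNIV (\<lambda>x. x + c)"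
    by (intro continuous_onI) (metis less_imp_le)
  then have m: "(\<lambda>x. x + c) \<in> borel_measurable borel"
    by (rule borel_measurable_continuous_onI)
  define S where "S = to_circle -` B"
  have S: "S \<in> sets borel"
    using measurable_sets[OF measurable_to_circle B] by (simp add: S_def)
  have per: "t + 1 \<in> S \<longleftrightarrow> t \<in> S" for t
    using to_circle_of_int_add[of t 1] by (simp add: S_def)
  have tr: "emeasure lborel X = emeasure lborel ((\<lambda>t. t + b) -` X)"
    if "X \<in> sets borel" for X and b :: real
    using that
    by (subst lborel_distr_plus[symmetric, of b], subst emeasure_distr) (auto simp: vimage_def add.commute)
  have Bc: "(\<lambda>x. x + c) -` B \<in> sets borel"
    using measurable_sets[OF m B] by simp
  have "emeasure (distr circle_haar circle_haar (\<lambda>x. x + c)) B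
      = emeasure circle_haar ((\<lambda>x. x + c) -` B)"
    using B m by (subst emeasure_distr) (auto simp: measurable_def)
  also have "\<dots> = emeasure lborel ((\<lambda>t. t + a) -` S \<inter> {0..<1})"
    using Bc by (simp add: emeasure_circle_haar S_def vimage_def ca to_circle_add)
  also have "(\<lambda>t. t + a) -` S \<inter> {0..<1} = (\<lambda>t. t + a) -` (S \<inter> {a..<1+a})"
    by auto
  also have "emeasure lborel \<dots> = emeasure lborel (S \<inter> {a..<1+a})"
    using S by (intro tr[symmetric]) auto
  also have "S \<inter> {a..<1+a} = (S \<inter> {a..<1}) \<union> (S \<inter> {1..<1+a})"
    using a by auto
  also have "emeasure lborel \<dots> = emeasure lborel (S \<inter> {a..<1}) + emeasure lborel (S \<inter> {1..<1+a})"
    using S by (intro plus_emeasure[symmetric]) auto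
  also have "emeasure lborel (S \<inter> {1..<1+a}) = emeasure lborel ((\<lambda>t. t + 1) -` (S \<inter> {1..<1+a}))"
    using S by (intro tr) auto
  also have "(\<lambda>t. t + 1) -` (S \<inter> {1..<1+a}) = S \<inter> {0..<a}"
    using per by auto
  also have "emeasure lborel (S \<inter> {a..<1}) + emeasure lborel (S \<inter> {0..<a})
      = emeasure lborel ((S \<inter> {a..<1}) \<union> (S \<inter> {0..<a}))"
    using S by (intro plus_emeasure) auto
  also have "(S \<inter> {a..<1}) \<union> (S \<inter> {0..<a}) = S \<inter> {0..<1}"
    using a by auto
  also have "emeasure lborel \<dots> = emeasure circle_haar B"
    using B by (simp add: emeasure_circle_haar S_def)
  finally show "emeasure (distr circle_haar circle_haar (\<lambda>x. x + c)) B = emeasure circle_haar B" .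
qed

section \<open>The torus\<close>

text \<open>The dimension is a natural number rather than a type, so that it can be quantified inside
  a formula: points are functions on \<open>{..<d}\<close>, extended by \<open>undefined\<close>.\<close>

definition torus :: "nat \<Rightarrow> (nat \<Rightarrow> circle) set" where
  "torus d = (\<Pi>\<^sub>E j\<in>{..<d}. UNIV)"

definition torus_haar :: "nat \<Rightarrow> (nat \<Rightarrow> circle) measure" where
  "torus_haar d = (\<Pi>\<^sub>M j\<in>{..<d}. circle_haar)"

lemma space_torus_haar: "space (torus_haar d) = torus d"
  by (simp add: torus_haar_def torus_def space_PiM)

lemma prob_space_torus_haar: "prob_space (torus_haar d)"
  unfolding torus_haar_def by (intro prob_space_PiM prob_space_circle_haar)

definition torus_dist :: "nat \<Rightarrow> (nat \<Rightarrow> circle) \<Rightarrow> (nat \<Rightarrow> circle) \<Rightarrow> real" where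
  "torus_dist d x y = Max ((\<lambda>j. circle_norm (x j - y j)) ` {..<d})"

definition translation :: "nat \<Rightarrow> (nat \<Rightarrow> circle) \<Rightarrow> (nat \<Rightarrow> circle) \<Rightarrow> (nat \<Rightarrow> circle)" where
  "translation d \<omega> x = (\<lambda>i\<in>{..<d}. x i + \<omega> i)"

definition birkhoff_sum ::
  "nat \<Rightarrow> (nat \<Rightarrow> circle) \<Rightarrow> ((nat \<Rightarrow> circle) \<Rightarrow> real) \<Rightarrow> nat \<Rightarrow> (nat \<Rightarrow> circle) \<Rightarrow> real" where
  "birkhoff_sum d \<omega> \<phi> N x = (\<Sum>j<N. \<phi> (translation d (\<lambda>i. circle_scale (int j) (\<omega> i)) x))"

lemma circle_scale_0: "circle_scale 0 x = 0"
  by transfer simp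

lemma circle_scale_Suc: "circle_scale (int (Suc j)) x = circle_scale (int j) x + x"
  by transfer (simp add: algebra_simps)

lemma birkhoff_sum_funpow:
  assumes "x \<in> torus d"
  shows "birkhoff_sum d \<omega> \<phi> N x = (\<Sum>j<N. \<phi> ((translation d \<omega> ^^ j) x))"
proof -
  have "translation d (\<lambda>i. circle_scale (int j) (\<omega> i)) x = (translation d \<omega> ^^ j) x" for j
  proof (induction j)
    case 0
    then show ?case
      using assms by (auto simp: translation_def circle_scale_0 torus_def PiE_def extensional_def)
  next
    case (Suc j)
    show ?case
      by (simp add: Suc.IH[symmetric] del: of_nat_Suc)
         (auto simp: translation_def circle_scale_Suc add.assoc simp del: of_nat_Suc)
  qed
  then show ?thesis by (simp add: birkhoff_sum_def)
qed

section \<open>Hoelder functions\<close>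

definition sup_norm :: "nat \<Rightarrow> ((nat \<Rightarrow> circle) \<Rightarrow> real) \<Rightarrow> real" where
  "sup_norm d f = (SUP x\<in>torus d. \<bar>f x\<bar>)"

text \<open>Boundedness of the function itself is not required separately: \<open>torus_dist\<close> is bounded,
  so it follows from boundedness of the difference quotients.\<close>

definition holder_quotients ::
  "nat \<Rightarrow> real \<Rightarrow> ((nat \<Rightarrow> circle) \<Rightarrow> real) \<Rightarrow> real set" where
  "holder_quotients d \<alpha> \<phi> =
     {\<bar>\<phi> x - \<phi> y\<bar> / torus_dist d x y powr \<alpha> | x y. x \<in> torus d \<and> y \<in> torus d \<and> x \<noteq> y}"

definition holder_space :: "nat \<Rightarrow> real \<Rightarrow> ((nat \<Rightarrow> circle) \<Rightarrow> real) set" where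
  "holder_space d \<alpha> = {\<phi>. bdd_above (holder_quotients d \<alpha> \<phi>)}"

definition holder_norm :: "nat \<Rightarrow> real \<Rightarrow> ((nat \<Rightarrow> circle) \<Rightarrow> real) \<Rightarrow> real" where
  "holder_norm d \<alpha> \<phi> = sup_norm d \<phi> + Sup (holder_quotients d \<alpha> \<phi>)"

section \<open>The Diophantine condition\<close>

text \<open>Frequencies are functions on all of \<open>nat\<close> of which only the values on \<open>{..<d}\<close> matter.\<close>

definition freq_norm :: "nat \<Rightarrow> (nat \<Rightarrow> int) \<Rightarrow> int" where
  "freq_norm d k = Max ((\<lambda>j. \<bar>k j\<bar>) ` {..<d})"

definition freq_dot :: "nat \<Rightarrow> (nat \<Rightarrow> int) \<Rightarrow> (nat \<Rightarrow> circle) \<Rightarrow> circle" where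
  "freq_dot d k x = (\<Sum>j<d. circle_scale (k j) (x j))"

definition diophantine :: "nat \<Rightarrow> real \<Rightarrow> real \<Rightarrow> (nat \<Rightarrow> circle) \<Rightarrow> bool" where
  "diophantine d \<gamma> A \<omega> \<longleftrightarrow>
     (\<forall>k. (\<exists>j<d. k j \<noteq> 0) \<longrightarrow>
        circle_norm (freq_dot d k \<omega>) \<ge> \<gamma> / real_of_int (freq_norm d k) powr A)"

end

theory Submission
  imports Defs
begin

text \<open>Convolving a mean zero \<open>\<psi>\<close> with a product of \<open>d\<close> Jackson kernels of degree at most \<open>2 m\<close> costs
  \<open>O(d H m\<^sup>-\<^sup>\<alpha>)\<close>, where \<open>H\<close> is the Hoelder seminorm. In the Birkhoff mean of the smoothed function
  each frequency \<open>k \<noteq> 0\<close> contributes at most \<open>H \<bar>k\<bar>\<^sup>-\<^sup>\<alpha> \<cdot> \<bar>k\<bar>\<^sup>A / (\<gamma> N)\<close>: the first factor is the decay of the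
  Fourier coefficients and the second the bound for the geometric sum. The kernel has total
  coefficient mass at most \<open>(2 m)\<^sup>d\<close>, so with \<open>(2 m)\<^sup>A\<^sup>+\<^sup>d \<approx> N\<close> both errors are of order \<open>m\<^sup>-\<^sup>\<alpha> / \<gamma>\<close>.
  The factor \<open>d\<close> is harmless because the Diophantine condition itself forces \<open>\<gamma> d \<le> 1\<close>.\<close>

section \<open>Characters of the circle\<close>

text \<open>The kernel in each variable is the normalized fourth power of the modulus of
  \<open>1 + z + ... + z^(m-1)\<close>. The square would give the Fejer kernel, whose first moment
  carries a logarithm and spoils the rate at \<open>\<alpha> = 1\<close>; the fourth power has
  second moment at most \<open>1/m^2\<close>, which serves all \<open>\<alpha> \<le> 1\<close> at
  once. What shapes the estimates is uniformity in \<open>d\<close>: a constant raised to the power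
  \<open>d\<close> would be fatal. The coefficient mass is therefore bounded by \<open>2 m\<close>
  per variable, the same quantity that bounds the frequencies, so the single requirement
  \<open>2 m \<le> N^(1/(A+d))\<close> absorbs the mass and the small divisors together. Second
  moments add over the coordinates, hence the smoothing error is only linear in \<open>d\<close>.
  The oscillating part also decays like \<open>m^-\<alpha>\<close>: a frequency of size
  \<open>n\<close> contributes \<open>n^(A-\<alpha>)\<close>, which is nondecreasing in
  \<open>n\<close> because \<open>A > d \<ge> 1 \<ge> \<alpha>\<close>, so the top frequency is the
  worst one and its decay factor is the one that survives.\<close>

lift_definition circle_cis :: "circle \<Rightarrow> complex" is "\<lambda>t. cis (2 * pi * t)"
proof -
  fix s t :: real
  assume "s - t \<in> \<int>"
  then obtain n where "s = t + of_int n"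
    by (metis Ints_cases add.commute diff_add_cancel)
  then have "2 * pi * s = 2 * pi * t + 2 * pi * of_int n"
    by (simp add: algebra_simps)
  then show "cis (2 * pi * s) = cis (2 * pi * t)"
    by (simp add: cis_mult[symmetric] cis_multiple_2pi)
qed

lemma circle_cis_0 [simp]: "circle_cis 0 = 1"
  by transfer simp

lemma circle_cis_add: "circle_cis (x + y) = circle_cis x * circle_cis y"
  by transfer (simp add: cis_mult algebra_simps)

lemma circle_cis_minus: "circle_cis (- x) = cnj (circle_cis x)"
  by transfer (simp add: cis_cnj)

lemma circle_cis_diff: "circle_cis (x - y) = circle_cis x * cnj (circle_cis y)"
  using circle_cis_add[of x "- y"] by (simp add: circle_cis_minus)

lemma norm_circle_cis [simp]: "cmod (circle_cis x) = 1"
  by transfer simp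

lemma circle_cis_scale_of_nat: "circle_cis (circle_scale (int n) x) = circle_cis x ^ n"
  by transfer (simp add: Complex.DeMoivre algebra_simps)

lemma circle_scale_add: "circle_scale k (x + y) = circle_scale k x + circle_scale k y"
  by transfer (simp add: algebra_simps)

lemma circle_scale_diff_left: "circle_scale (k - l) x = circle_scale k x - circle_scale l x"
  by transfer (simp add: algebra_simps)

lemma circle_scale_scale: "circle_scale k (circle_scale l x) = circle_scale (k * l) x"
  by transfer simp

lemma circle_scale_zero_right [simp]: "circle_scale k 0 = 0"
  by transfer simp

lemma circle_scale_one [simp]: "circle_scale 1 x = x"
  by transfer simp

lemma to_circle_surj: obtains t where "x = to_circle t"
  by (metis Quotient_circle Quotient_abs_rep)

lemma circle_norm_nonneg [simp]: "0 \<le> circle_norm x"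
  by transfer (simp add: infdist_nonneg)

lemma circle_norm_le_half: "circle_norm x \<le> 1 / 2"
proof -
  obtain t where "x = to_circle t" by (rule to_circle_surj)
  then show ?thesis
    using of_int_round_abs_le[of t] by (simp add: circle_norm_to_circle abs_minus_commute)
qed

lemma circle_norm_minus: "circle_norm (- x) = circle_norm x"
proof -
  have "circle_norm 0 = 0" by (simp add: circle_norm_eq_0_iff)
  then show ?thesis
    using circle_norm_diff_le[of 0 x] circle_norm_diff_le[of 0 "- x"] by simp
qed

lemma circle_norm_to_circle_le: "circle_norm (to_circle t) \<le> \<bar>t\<bar>"
  using round_diff_minimal[of t 0] by (simp add: circle_norm_to_circle)

lemma circle_norm_0 [simp]: "circle_norm 0 = 0"
  by (simp add: circle_norm_eq_0_iff)

text \<open>Subtracting the nearest integer yields a representative \<open>t\<close> in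
  \<open>[-1/2, 1/2]\<close>. Both comparisons of chord and arc length below are read off this
  \<open>t\<close>.\<close>

lemma dist_circle_cis_one:
  obtains t where "\<bar>t\<bar> = circle_norm x" "cmod (circle_cis x - 1) = 2 * \<bar>sin (pi * t)\<bar>"
proof -
  obtain s where s: "x = to_circle s" by (rule to_circle_surj)
  define t where "t = s - of_int (round s)"
  have x: "x = to_circle t"
    using to_circle_of_int_add[of t "round s"] by (simp add: s t_def)
  have "circle_cis x = cis (2 * pi * t)"
    unfolding x by transfer simp
  moreover have "cmod (cis (2 * pi * t) - 1) = 2 * \<bar>sin (pi * t)\<bar>"
    using dist_exp_i_1[of "2 * pi * t"] by (simp add: cis_conv_exp)
  moreover have "\<bar>t\<bar> = circle_norm x"
    by (simp add: s circle_norm_to_circle t_def)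
  ultimately show ?thesis using that x by metis
qed

text \<open>A weak form of Jordan's inequality from the cubic Taylor bound: for
  \<open>x \<le> 2\<close> the error \<open>x^3/6\<close> is at most \<open>2x/3\<close>. The factor
  \<open>1/3\<close> is affordable because it is only paired with \<open>pi > 3\<close>.\<close>

lemma sin_ge_third:
  assumes "0 \<le> x" "x \<le> pi / 2"
  shows "x / 3 \<le> sin x"
proof -
  have "\<bar>sin x - (\<Sum>m<3. sin_coeff m * x ^ m)\<bar> \<le> inverse (fact 3) * \<bar>x\<bar> ^ 3"
    by (rule Maclaurin_sin_bound)
  then have "\<bar>sin x - x\<bar> \<le> x ^ 3 / 6"
    using assms by (simp add: sin_coeff_def numeral_3_eq_3 fact_numeral field_simps)
  moreover have "x ^ 3 / 6 \<le> x * (2 / 3)"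
  proof -
    have "x \<le> 2" using assms pi_less_4 by simp
    then have "x * x \<le> 2 * 2" using assms by (intro mult_mono) auto
    then have "x * (x * x) \<le> x * 4" using assms by (intro mult_left_mono) auto
    then show ?thesis by (simp add: power3_eq_cube algebra_simps)
  qed
  ultimately show ?thesis by linarith
qed

text \<open>The lower bound behind both the small divisors and the second moment of the kernel. The
  sharp constant is 4; with 2 it cancels exactly against \<open>\<bar>z^N - 1\<bar> \<le> 2\<close>
  in the geometric sum.\<close>

lemma circle_norm_le_dist_cis: "2 * circle_norm x \<le> cmod (circle_cis x - 1)"
proof -
  obtain t where t: "\<bar>t\<bar> = circle_norm x" "cmod (circle_cis x - 1) = 2 * \<bar>sin (pi * t)\<bar>"
    by (rule dist_circle_cis_one)
  have "pi * \<bar>t\<bar> \<le> pi * (1 / 2)"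
    using circle_norm_le_half[of x] t(1) by (intro mult_left_mono) auto
  then have "pi * \<bar>t\<bar> / 3 \<le> sin (pi * \<bar>t\<bar>)"
    by (intro sin_ge_third) auto
  moreover have "sin (pi * \<bar>t\<bar>) \<le> \<bar>sin (pi * t)\<bar>"
    by (auto simp: abs_if)
  moreover have "3 * \<bar>t\<bar> \<le> pi * \<bar>t\<bar>"
    using pi_gt3 by (intro mult_right_mono) auto
  ultimately show ?thesis using t by simp
qed

text \<open>Serves to make \<open>circle_cis\<close> Lipschitz, hence Borel measurable.\<close>

lemma dist_cis_le_circle_norm: "cmod (circle_cis x - 1) \<le> 8 * circle_norm x"
proof -
  obtain t where t: "\<bar>t\<bar> = circle_norm x" "cmod (circle_cis x - 1) = 2 * \<bar>sin (pi * t)\<bar>"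
    by (rule dist_circle_cis_one)
  have "\<bar>sin (pi * t)\<bar> \<le> pi * \<bar>t\<bar>"
    using abs_sin_x_le_abs_x[of "pi * t"] by (simp add: abs_mult)
  also have "\<dots> \<le> 4 * \<bar>t\<bar>"
    using pi_less_4 by (intro mult_right_mono) auto
  finally show ?thesis using t by simp
qed

section \<open>Borel measurability of the basic functions on the circle\<close>

lemma measurable_circle_cis [measurable]: "circle_cis \<in> borel_measurable borel"
proof -
  have "dist (circle_cis x) (circle_cis y) \<le> 8 * dist x y" for x y
  proof -
    have "cmod (circle_cis x - circle_cis y) = cmod (circle_cis y * (circle_cis (x - y) - 1))"
      by (simp add: algebra_simps circle_cis_add[symmetric])
    also have "\<dots> \<le> 8 * circle_norm (x - y)"
      unfolding norm_mult using dist_cis_le_circle_norm[of "x - y"] by simp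
    finally show ?thesis by (simp add: dist_norm dist_circle_def)
  qed
  then have "8-lipschitz_on UNIV circle_cis"
    by (intro lipschitz_onI) auto
  then show ?thesis
    by (intro borel_measurable_continuous_onI lipschitz_on_continuous_on)
qed

lemma measurable_circle_norm [measurable]: "circle_norm \<in> borel_measurable borel"
proof -
  have "circle_norm = (\<lambda>x. dist x 0)" by (simp add: dist_circle_def fun_eq_iff)
  moreover have "continuous_on UNIV (\<lambda>x::circle. dist x 0)"
    by (intro continuous_intros)
  ultimately show ?thesis
    by (simp only: borel_measurable_continuous_onI)
qed

lemma measurable_circle_add [measurable]: "(\<lambda>x. x + c) \<in> measurable borel (borel :: circle measure)"
proof -
  have "dist (x + c) (y + c) = dist x y" for x y :: circle
    by (simp add: dist_circle_def)
  then have "continuous_on UNIV (\<lambda>x. x + c)"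
    by (intro continuous_onI) (metis less_imp_le)
  then show ?thesis
    by (rule borel_measurable_continuous_onI)
qed

lemma measurable_circle_cis_scale [measurable]:
  "(\<lambda>x. circle_cis (circle_scale k x)) \<in> borel_measurable borel"
proof -
  \<comment> \<open>A character of negative frequency is the conjugate of a natural power of
    \<open>circle_cis\<close>.\<close>
  obtain n :: nat where "k = int n \<or> k = - int n" by (metis int_cases2)
  then have "(\<lambda>x. circle_cis (circle_scale k x)) = (\<lambda>x. circle_cis x ^ n)
    \<or> (\<lambda>x. circle_cis (circle_scale k x)) = (\<lambda>x. cnj (circle_cis x ^ n))"
    using circle_scale_diff_left[of 0 "int n"]
    by (auto simp: fun_eq_iff circle_cis_scale_of_nat circle_scale_0 circle_cis_minus)
  moreover have "(\<lambda>x. cnj (circle_cis x ^ n)) \<in> borel_measurable borel"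
    by (rule borel_measurable_continuous_on[OF continuous_on_cnj[OF continuous_on_id]]) measurable
  ultimately show ?thesis by (elim disjE) simp_all
qed

section \<open>Orthogonality of characters and Parseval's identity\<close>

interpretation circle_haar: prob_space circle_haar
  by (rule prob_space_circle_haar)

lemma integral_circle_haar_translate:
  fixes f :: "circle \<Rightarrow> complex"
  assumes "f \<in> borel_measurable borel"
  shows "(\<integral>x. f (x + c) \<partial>circle_haar) = (\<integral>x. f x \<partial>circle_haar)"
  using assms
  by (subst (2) circle_haar_translation_invariant[of c, symmetric]) (simp add: integral_distr)

text \<open>Translation by this point reverses the sign of the character of frequency
  \<open>k\<close>. This drives both the orthogonality relation and the decay of Fourier
  coefficients.\<close>

lemma circle_scale_half_period:
  assumes "k \<noteq> 0"
  shows "circle_cis (circle_scale k (to_circle (1 / (2 * of_int k)))) = - 1"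
  using assms by transfer (simp add: field_simps)

text \<open>For \<open>k \<noteq> 0\<close>, invariance under the half-period translation forces the
  integral to equal its own negative, which replaces an explicit integration over
  \<open>[0,1)\<close>.\<close>

lemma integral_circle_character:
  "(\<integral>x. circle_cis (circle_scale k x) \<partial>circle_haar) = of_bool (k = 0)"
proof (cases "k = 0")
  case True
  then show ?thesis
    using circle_haar.prob_space by (simp add: circle_scale_0)
next
  case False
  have "(\<integral>x. circle_cis (circle_scale k x) \<partial>circle_haar)
      = (\<integral>x. circle_cis (circle_scale k (x + to_circle (1 / (2 * of_int k)))) \<partial>circle_haar)"
    by (rule integral_circle_haar_translate[symmetric]) simp
  also have "\<dots> = - (\<integral>x. circle_cis (circle_scale k x) \<partial>circle_haar)"
    using False by (simp add: circle_scale_add circle_cis_add circle_scale_half_period)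
  finally have "2 * (\<integral>x. circle_cis (circle_scale k x) \<partial>circle_haar) = 0"
    unfolding mult_2 by (simp only: eq_neg_iff_add_eq_0)
  then show ?thesis using False by simp
qed

text \<open>The double sum is kept over pairs \<open>(s, t)\<close> although the differences
  \<open>s - t\<close> repeat. The kernel inherits this indexing, so coefficients never have to be
  collected by frequency.\<close>

lemma norm_circle_polynomial_sq:
  fixes b :: "nat \<Rightarrow> real"
  shows "complex_of_real ((cmod (\<Sum>s<n. of_real (b s) * circle_cis x ^ s))\<^sup>2)
    = (\<Sum>s<n. \<Sum>t<n. of_real (b s * b t) * circle_cis (circle_scale (int s - int t) x))"
proof -
  let ?f = "\<lambda>s. complex_of_real (b s) * circle_cis x ^ s"
  have "complex_of_real ((cmod (\<Sum>s<n. ?f s))\<^sup>2) = (\<Sum>s<n. \<Sum>t<n. ?f s * cnj (?f t))"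
    by (simp only: complex_norm_square cnj_sum sum_product)
  also have "\<dots> = (\<Sum>s<n. \<Sum>t<n. of_real (b s * b t) * circle_cis (circle_scale (int s - int t) x))"
    by (intro sum.cong refl)
      (simp only: circle_scale_diff_left circle_cis_diff circle_cis_scale_of_nat
        complex_cnj_mult complex_cnj_complex_of_real of_real_mult mult_ac)
  finally show ?thesis .
qed

text \<open>Only the diagonal \<open>s = t\<close> survives integration. Applied twice to the
  kernel: for its normalization and for its second moment.\<close>

lemma integral_circle_parseval:
  fixes b :: "nat \<Rightarrow> real"
  shows "(\<integral>x. (cmod (\<Sum>s<n. of_real (b s) * circle_cis x ^ s))\<^sup>2 \<partial>circle_haar) = (\<Sum>s<n. (b s)\<^sup>2)"
proof -
  have int: "integrable circle_haar (\<lambda>x. circle_cis (circle_scale k x))" for k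
    by (rule circle_haar.integrable_const_bound[where B = 1]) simp_all
  have "complex_of_real (\<integral>x. (cmod (\<Sum>s<n. of_real (b s) * circle_cis x ^ s))\<^sup>2 \<partial>circle_haar)
      = (\<integral>x. (\<Sum>s<n. \<Sum>t<n. of_real (b s * b t) * circle_cis (circle_scale (int s - int t) x)) \<partial>circle_haar)"
    by (simp only: integral_complex_of_real[symmetric] norm_circle_polynomial_sq)
  also have "\<dots> = (\<Sum>s<n. \<Sum>t<n. of_real (b s * b t) * of_bool (s = t))"
    by (simp add: Bochner_Integration.integral_sum Bochner_Integration.integrable_sum int integral_circle_character
        del: of_real_mult)
  also have "\<dots> = (\<Sum>s<n. of_real ((b s)\<^sup>2))"
    by (simp add: power2_eq_square if_distrib of_bool_def sum.delta cong: if_cong)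
  finally show ?thesis
    by (simp only: of_real_sum[symmetric] of_real_eq_iff)
qed

section \<open>The Jackson kernel\<close>

text \<open>The triangular sequence \<open>1, 2, ..., m, ..., 2, 1\<close>, followed by a zero at
  \<open>s = 2 m - 1\<close>; counting pairs avoids a case distinction between its two
  slopes.\<close>

definition square_coeff :: "nat \<Rightarrow> nat \<Rightarrow> real" where
  "square_coeff m s = real (card {p \<in> {..<m} \<times> {..<m}. fst p + snd p = s})"

text \<open>Stated over a general algebra so that it can be evaluated on the complex unit circle and
  also at the real number 1, where it gives the total of the coefficients.\<close>

lemma geometric_sum_square:
  fixes z :: "'a :: {comm_semiring_1, real_algebra_1}"
  shows "(\<Sum>i<m. z ^ i)\<^sup>2 = (\<Sum>s<2 * m. of_real (square_coeff m s) * z ^ s)"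
proof -
  have "(\<Sum>i<m. z ^ i)\<^sup>2 = (\<Sum>p\<in>{..<m} \<times> {..<m}. z ^ (fst p + snd p))"
    by (simp add: power2_eq_square sum_product sum.cartesian_product power_add case_prod_beta)
  also have "\<dots> = (\<Sum>s<2 * m. \<Sum>p | p \<in> {..<m} \<times> {..<m} \<and> fst p + snd p = s. z ^ (fst p + snd p))"
    by (rule sum.group[symmetric]) auto
  also have "\<dots> = (\<Sum>s<2 * m. of_real (square_coeff m s) * z ^ s)"
    by (intro sum.cong) (auto simp: square_coeff_def)
  finally show ?thesis .
qed

lemma sum_square_coeff: "(\<Sum>s<2 * m. square_coeff m s) = (real m)\<^sup>2"
  using geometric_sum_square[of "1 :: real" m] by simp

text \<open>Cauchy-Schwarz: a total of \<open>m^2\<close> spread over \<open>2 m\<close>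
  coefficients has sum of squares at least \<open>m^4 / (2 m)\<close>.\<close>

lemma sum_square_coeff_sq_ge: "m > 0 \<Longrightarrow> real m ^ 3 / 2 \<le> (\<Sum>s<2 * m. (square_coeff m s)\<^sup>2)"
proof -
  assume "m > 0"
  have "(\<Sum>s<2 * m. square_coeff m s)\<^sup>2 \<le> (\<Sum>s<2 * m. (square_coeff m s)\<^sup>2) * real (2 * m)"
    using sum_squared_le_sum_of_squares[of "square_coeff m" "{..<2 * m}"] by simp
  then have "real m * (2 * (\<Sum>s<2 * m. (square_coeff m s)\<^sup>2)) \<ge> real m * real m ^ 3"
    unfolding sum_square_coeff by (simp add: algebra_simps power2_eq_square power3_eq_cube)
  then have "2 * (\<Sum>s<2 * m. (square_coeff m s)\<^sup>2) \<ge> real m ^ 3"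
    using \<open>m > 0\<close> mult_le_cancel_left_pos[of "real m"] by simp
  then show ?thesis by simp
qed

text \<open>All constants come from the normalizing factor \<open>S \<ge> m^3 / 2\<close>. The
  weights are nonnegative, so their sum is the value of the kernel at 0, namely
  \<open>m^4 / S \<le> 2 m\<close>. For the second moment, one factor \<open>z - 1\<close> cancels a
  denominator of the squared geometric sum.\<close>

lemma jackson_kernel:
  fixes m :: nat
  assumes "m > 0"
  obtains P :: "(nat \<times> nat) set" and w :: "nat \<times> nat \<Rightarrow> real" and \<kappa> :: "nat \<times> nat \<Rightarrow> int"
    and K :: "circle \<Rightarrow> real"
  where "finite P" "\<forall>p. 0 \<le> w p" "(\<Sum>p\<in>P. w p) \<le> 2 * real m" "\<forall>p\<in>P. \<bar>\<kappa> p\<bar> \<le> 2 * int m"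
    "\<forall>x. complex_of_real (K x) = (\<Sum>p\<in>P. of_real (w p) * circle_cis (circle_scale (\<kappa> p) x))"
    "\<forall>x. 0 \<le> K x" "K \<in> borel_measurable borel" "(\<integral>x. K x \<partial>circle_haar) = 1"
    "(\<integral>x. K x * (circle_norm x)\<^sup>2 \<partial>circle_haar) \<le> 1 / (real m)\<^sup>2"
proof -
  define D where "D x = (\<Sum>s<m. circle_cis x ^ s)" for x
  define b where "b = square_coeff m"
  define S where "S = (\<Sum>s<2 * m. (b s)\<^sup>2)"
  define P where "P = {..<2 * m} \<times> {..<2 * m}"
  define w where "w p = b (fst p) * b (snd p) / S" for p
  define \<kappa> where "\<kappa> p = int (fst p) - int (snd p)" for p
  define K where "K x = (cmod (D x ^ 2))\<^sup>2 / S" for x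
  have S: "real m ^ 3 / 2 \<le> S"
    unfolding S_def b_def by (rule sum_square_coeff_sq_ge) fact
  then have S_pos: "S > 0"
    by (rule less_le_trans[rotated]) (use assms in simp)
  have D2: "D x ^ 2 = (\<Sum>s<2 * m. of_real (b s) * circle_cis x ^ s)" for x
    unfolding D_def b_def by (rule geometric_sum_square)
  have [measurable]: "D \<in> borel_measurable borel"
    unfolding D_def by measurable
  have K_meas [measurable]: "K \<in> borel_measurable borel"
    unfolding K_def by measurable
  have "(\<Sum>p\<in>P. w p) = (real m)\<^sup>2 * (real m)\<^sup>2 / S"
  proof -
    have "(\<Sum>p\<in>P. w p) = (\<Sum>s<2 * m. b s) * (\<Sum>t<2 * m. b t) / S"
      unfolding P_def w_def sum_product
      by (simp only: sum_divide_distrib sum.cartesian_product case_prod_beta)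
    then show ?thesis by (simp only: b_def sum_square_coeff)
  qed
  also have "\<dots> \<le> (real m)\<^sup>2 * (real m)\<^sup>2 / (real m ^ 3 / 2)"
    using S assms by (intro divide_left_mono) (auto intro!: mult_pos_pos S_pos)
  also have "\<dots> = 2 * real m"
    using assms by (simp add: field_simps flip: power_add)
      (simp add: power4_eq_xxxx power3_eq_cube)
  finally have w_sum: "(\<Sum>p\<in>P. w p) \<le> 2 * real m" .
  have expansion: "complex_of_real (K x) = (\<Sum>p\<in>P. of_real (w p) * circle_cis (circle_scale (\<kappa> p) x))" for x
    unfolding K_def D2 P_def w_def \<kappa>_def of_real_divide norm_circle_polynomial_sq
    by (simp add: sum_divide_distrib sum.cartesian_product case_prod_beta)
  have total: "(\<integral>x. K x \<partial>circle_haar) = 1"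
    unfolding K_def D2 using S_pos
    by (simp add: integral_circle_parseval S_def[symmetric])
  \<comment> \<open>multiplying the squared geometric sum by \<open>z - 1\<close> leaves a polynomial with coefficients \<open>\<plusminus>1\<close>\<close>
  have D2_diff: "D x ^ 2 * (circle_cis x - 1)
      = (\<Sum>s<2 * m. of_real (if s < m then - 1 else 1) * circle_cis x ^ s)" for x
  proof -
    have "D x * (circle_cis x - 1) = circle_cis x ^ m - 1"
      unfolding D_def by (simp add: power_diff_1_eq mult.commute)
    then have "D x ^ 2 * (circle_cis x - 1) = D x * (circle_cis x ^ m - 1)"
      by (simp only: power2_eq_square mult.assoc)
    then have "D x ^ 2 * (circle_cis x - 1) = D x * circle_cis x ^ m - D x"
      by (simp add: right_diff_distrib)
    also have "\<dots> = (\<Sum>s<m. circle_cis x ^ (m + s)) - (\<Sum>s<m. circle_cis x ^ s)"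
      by (simp add: D_def sum_distrib_left power_add mult.commute)
    also have "(\<Sum>s<m. circle_cis x ^ (m + s)) = (\<Sum>s\<in>{m..<2 * m}. circle_cis x ^ s)"
      by (rule sum.reindex_bij_witness[of _ "\<lambda>s. s - m" "\<lambda>s. m + s"]) auto
    finally have *: "D x ^ 2 * (circle_cis x - 1) = (\<Sum>s\<in>{m..<2 * m}. circle_cis x ^ s) - (\<Sum>s<m. circle_cis x ^ s)" .
    let ?g = "\<lambda>s. complex_of_real (if s < m then - 1 else 1) * circle_cis x ^ s"
    have split: "{..<2 * m} = {..<m} \<union> {m..<2 * m}" by auto
    have "(\<Sum>s<2 * m. ?g s) = (\<Sum>s<m. ?g s) + (\<Sum>s\<in>{m..<2 * m}. ?g s)"
      unfolding split by (subst sum.union_disjoint) auto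
    also have "(\<Sum>s<m. ?g s) = - (\<Sum>s<m. circle_cis x ^ s)"
      by (simp add: sum_negf)
    also have "(\<Sum>s\<in>{m..<2 * m}. ?g s) = (\<Sum>s\<in>{m..<2 * m}. circle_cis x ^ s)"
      by (intro sum.cong) auto
    finally show ?thesis using * by simp
  qed
  have "integrable circle_haar (\<lambda>x. (cmod (D x ^ 2 * (circle_cis x - 1)))\<^sup>2)"
  proof (rule circle_haar.integrable_const_bound[where B = "(\<Sum>s<2 * m. 1)\<^sup>2"])
    show "AE x in circle_haar. norm ((cmod (D x ^ 2 * (circle_cis x - 1)))\<^sup>2) \<le> (\<Sum>s<2 * m. 1)\<^sup>2"
      unfolding D2_diff real_norm_def abs_power2
      by (intro AE_I2 power_mono sum_norm_le norm_ge_zero) (auto simp: norm_mult norm_power)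
  qed measurable
  then have "(\<integral>x. K x * (circle_norm x)\<^sup>2 \<partial>circle_haar)
      \<le> (\<integral>x. (cmod (D x ^ 2 * (circle_cis x - 1)))\<^sup>2 / (4 * S) \<partial>circle_haar)"
  proof (intro integral_mono')
    fix x
    \<comment> \<open>Comparing \<open>circle_norm x\<close> with the chord
      \<open>\<bar>z - 1\<bar>\<close> turns the moment into an integral of a squared trigonometric
      polynomial, at the gain of a factor 4.\<close>
    have "(2 * circle_norm x)\<^sup>2 \<le> (cmod (circle_cis x - 1))\<^sup>2"
      by (intro power_mono circle_norm_le_dist_cis) simp
    then have "(cmod (D x ^ 2))\<^sup>2 / (4 * S) * (2 * circle_norm x)\<^sup>2
      \<le> (cmod (D x ^ 2))\<^sup>2 / (4 * S) * (cmod (circle_cis x - 1))\<^sup>2"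
      using S_pos by (intro mult_left_mono) auto
    then show "K x * (circle_norm x)\<^sup>2 \<le> (cmod (D x ^ 2 * (circle_cis x - 1)))\<^sup>2 / (4 * S)"
      by (simp add: K_def norm_mult power_mult_distrib)
  qed (use S_pos in auto)
  \<comment> \<open>Parseval for a polynomial with \<open>2 m\<close> coefficients of modulus one;
    the bound on \<open>S\<close> then makes the constant in \<open>1/m^2\<close> exactly 1.\<close>
  also have "\<dots> = real (2 * m) / (4 * S)"
  proof -
    have "(\<Sum>s<2 * m. (if s < m then - 1 else 1 :: real)\<^sup>2) = (\<Sum>s<2 * m. 1)"
      by (intro sum.cong) auto
    then show ?thesis
      unfolding D2_diff integral_divide_zero integral_circle_parseval by simp
  qed
  also have "\<dots> \<le> real (2 * m) / (4 * (real m ^ 3 / 2))"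
    using S assms S_pos by (intro divide_left_mono) (auto intro!: mult_pos_pos)
  also have "\<dots> = 1 / (real m)\<^sup>2"
    using assms by (simp add: field_simps power2_eq_square power3_eq_cube)
  finally have "(\<integral>x. K x * (circle_norm x)\<^sup>2 \<partial>circle_haar) \<le> 1 / (real m)\<^sup>2" .
  moreover have "0 \<le> w p" for p
    using S_pos by (simp add: w_def b_def square_coeff_def)
  moreover have "\<bar>\<kappa> p\<bar> \<le> 2 * int m" if "p \<in> P" for p
    using that by (auto simp: P_def \<kappa>_def)
  moreover have "0 \<le> K x" for x
    using S_pos by (simp add: K_def)
  moreover have "finite P" by (simp add: P_def)
  ultimately show ?thesis
    using that w_sum expansion K_meas total by blast
qed

section \<open>Integration over the torus and Hoelder functions\<close>

interpretation torus_haar: prob_space "torus_haar d" for d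
  by (rule prob_space_torus_haar)

interpretation circle_product: product_sigma_finite "\<lambda>_ :: nat. circle_haar"
  by unfold_locales

lemma torus_not_empty: "torus d \<noteq> {}"
  by (simp add: torus_def PiE_eq_empty_iff)

lemma translation_in_torus [simp]: "translation d c x \<in> torus d"
  by (simp add: translation_def torus_def)

lemma measurable_torus_component:
  assumes "j < d" "f \<in> measurable borel N"
  shows "(\<lambda>x. f (x j)) \<in> measurable (torus_haar d) N"
proof -
  have "(\<lambda>x. x j) \<in> measurable (torus_haar d) circle_haar"
    unfolding torus_haar_def using assms(1) by (intro measurable_component_singleton) auto
  moreover have "f \<in> measurable circle_haar N"
    using assms(2) by (simp cong: measurable_cong_sets)
  ultimately show ?thesis
    by (rule measurable_compose)
qed

lemma measurable_translation: "translation d c \<in> measurable (torus_haar d) (torus_haar d)"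
proof -
  have "(\<lambda>x. x i + c i) \<in> measurable (torus_haar d) circle_haar" if "i < d" for i
    using that measurable_torus_component[of i d "\<lambda>x. x + c i" borel] by simp
  then show ?thesis
    unfolding translation_def[abs_def] torus_haar_def[of d]
    by (intro measurable_restrict) (auto simp: torus_haar_def)
qed

text \<open>A product measure is determined by its values on boxes. Translation acts coordinatewise
  and pulls boxes back to boxes, so invariance of the factors suffices.\<close>

lemma torus_haar_translation_invariant: "distr (torus_haar d) (torus_haar d) (translation d c) = torus_haar d"
  unfolding torus_haar_def[of d]
proof (rule circle_product.PiM_eqI)
  fix A :: "nat \<Rightarrow> circle set"
  assume A: "\<And>i. i \<in> {..<d} \<Longrightarrow> A i \<in> sets circle_haar"
  have inv: "emeasure circle_haar ((\<lambda>x. x + c i) -` A i) = emeasure circle_haar (A i)" if "i < d" for i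
    using A that
    by (subst (2) circle_haar_translation_invariant[of "c i", symmetric]) (simp add: emeasure_distr)
  let ?B = "\<lambda>i. (\<lambda>x. x + c i) -` A i"
  have pre: "translation d c -` (Pi\<^sub>E {..<d} A) \<inter> space (torus_haar d) = Pi\<^sub>E {..<d} ?B"
    unfolding space_torus_haar by (auto simp: translation_def torus_def PiE_iff)
  have B: "?B i \<in> sets circle_haar" if "i < d" for i
    using A[of i] that measurable_sets[OF measurable_circle_add, of "A i" "c i"] by simp
  have "Pi\<^sub>E {..<d} A \<in> sets (torus_haar d)"
    unfolding torus_haar_def using A by (intro sets_PiM_I_finite) auto
  then have "emeasure (distr (torus_haar d) (torus_haar d) (translation d c)) (Pi\<^sub>E {..<d} A)
      = emeasure (torus_haar d) (Pi\<^sub>E {..<d} ?B)"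
    by (simp only: emeasure_distr[OF measurable_translation] pre)
  also have "\<dots> = (\<Prod>i<d. emeasure circle_haar (?B i))"
    unfolding torus_haar_def by (rule circle_product.emeasure_PiM) (use B in auto)
  finally have "emeasure (distr (torus_haar d) (torus_haar d) (translation d c)) (Pi\<^sub>E {..<d} A)
      = (\<Prod>i<d. emeasure circle_haar (?B i))" .
  then show "emeasure (distr (\<Pi>\<^sub>M j\<in>{..<d}. circle_haar) (\<Pi>\<^sub>M j\<in>{..<d}. circle_haar) (translation d c)) (Pi\<^sub>E {..<d} A)
      = (\<Prod>i\<in>{..<d}. emeasure circle_haar (A i))"
    by (simp add: inv torus_haar_def)
qed simp_all

lemma integral_torus_translate:
  fixes f :: "(nat \<Rightarrow> circle) \<Rightarrow> 'b :: {banach, second_countable_topology}"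
  assumes "f \<in> borel_measurable (torus_haar d)"
  shows "(\<integral>x. f (translation d c x) \<partial>torus_haar d) = (\<integral>x. f x \<partial>torus_haar d)"
  using integral_distr[OF measurable_translation assms, of c]
  by (simp add: torus_haar_translation_invariant)

lemma circle_cis_sum: "circle_cis (\<Sum>j\<in>I. f j) = (\<Prod>j\<in>I. circle_cis (f j))"
  by (induction I rule: infinite_finite_induct) (simp_all add: circle_cis_add)

lemma measurable_torus_character [measurable]:
  "(\<lambda>x. circle_cis (freq_dot d k x)) \<in> borel_measurable (torus_haar d)"
  unfolding freq_dot_def circle_cis_sum
  by (intro borel_measurable_prod) (simp add: measurable_torus_component[OF _ measurable_circle_cis_scale])

lemma freq_dot_translation: "freq_dot d k (translation d c x) = freq_dot d k x + freq_dot d k c"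
  by (simp add: freq_dot_def translation_def circle_scale_add sum.distrib)

lemma freq_dot_scale: "freq_dot d k (\<lambda>i. circle_scale l (x i)) = circle_scale l (freq_dot d k x)"
proof -
  have "circle_scale l (\<Sum>j\<in>J. f j) = (\<Sum>j\<in>J. circle_scale l (f j))" for J :: "nat set" and f
    by (induction J rule: infinite_finite_induct) (simp_all add: circle_scale_add)
  then show ?thesis
    by (simp add: freq_dot_def circle_scale_scale mult.commute)
qed

section \<open>The maximum metric on the torus and the size of frequencies\<close>

lemma circle_norm_le_torus_dist: "j < d \<Longrightarrow> circle_norm (x j - y j) \<le> torus_dist d x y"
  unfolding torus_dist_def by (intro Max_ge) auto

lemma torus_dist_attained:
  assumes "d \<ge> 1"
  obtains j where "j < d" "torus_dist d x y = circle_norm (x j - y j)"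
proof -
  have "torus_dist d x y \<in> (\<lambda>j. circle_norm (x j - y j)) ` {..<d}"
    unfolding torus_dist_def using assms by (intro Max_in) (auto simp: lessThan_empty_iff)
  then show ?thesis using that by auto
qed

lemma torus_dist_nonneg: "d \<ge> 1 \<Longrightarrow> 0 \<le> torus_dist d x y"
  by (metis torus_dist_attained circle_norm_nonneg)

lemma torus_dist_le_one: "d \<ge> 1 \<Longrightarrow> torus_dist d x y \<le> 1"
  using circle_norm_le_half by (metis torus_dist_attained field_sum_of_halves add_increasing2 order_trans zero_le_divide_1_iff zero_le_numeral)

lemma torus_dist_pos:
  assumes "d \<ge> 1" "x \<in> torus d" "y \<in> torus d" "x \<noteq> y"
  shows "0 < torus_dist d x y"
proof -
  obtain j where j: "j < d" "x j \<noteq> y j"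
    using assms by (metis PiE_ext lessThan_iff torus_def)
  then have "0 < circle_norm (x j - y j)"
    using circle_norm_eq_0_iff[of "x j - y j"] circle_norm_nonneg[of "x j - y j"]
    by (simp add: order.strict_iff_order del: circle_norm_nonneg)
  also have "\<dots> \<le> torus_dist d x y"
    using j by (intro circle_norm_le_torus_dist)
  finally show ?thesis .
qed

lemma freq_norm_attained:
  assumes "d \<ge> 1"
  obtains j where "j < d" "freq_norm d k = \<bar>k j\<bar>"
proof -
  have "freq_norm d k \<in> (\<lambda>j. \<bar>k j\<bar>) ` {..<d}"
    unfolding freq_norm_def using assms by (intro Max_in) (auto simp: lessThan_empty_iff)
  then show ?thesis using that by auto
qed

lemma abs_le_freq_norm: "j < d \<Longrightarrow> \<bar>k j\<bar> \<le> freq_norm d k"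
  unfolding freq_norm_def by (intro Max_ge) auto

lemma freq_norm_pos: "j < d \<Longrightarrow> k j \<noteq> 0 \<Longrightarrow> 0 < freq_norm d k"
  using abs_le_freq_norm[of j d k] by simp

text \<open>The product form covers \<open>x = y\<close> as well, and a bound of this kind passes
  unchanged from \<open>\<phi>\<close> to \<open>\<phi>\<close> minus its mean.\<close>

definition holder_bound :: "nat \<Rightarrow> real \<Rightarrow> real \<Rightarrow> ((nat \<Rightarrow> circle) \<Rightarrow> real) \<Rightarrow> bool" where
  "holder_bound d \<alpha> H \<phi> \<longleftrightarrow> 0 \<le> H \<and>
     (\<forall>x\<in>torus d. \<forall>y\<in>torus d. \<bar>\<phi> x - \<phi> y\<bar> \<le> H * torus_dist d x y powr \<alpha>)"

lemma holder_boundD: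
  "holder_bound d \<alpha> H \<phi> \<Longrightarrow> x \<in> torus d \<Longrightarrow> y \<in> torus d \<Longrightarrow> \<bar>\<phi> x - \<phi> y\<bar> \<le> H * torus_dist d x y powr \<alpha>"
  by (simp add: holder_bound_def)

lemma holder_bound_oscillation:
  assumes "holder_bound d \<alpha> H \<phi>" "d \<ge> 1" "0 < \<alpha>" "x \<in> torus d" "y \<in> torus d"
  shows "\<bar>\<phi> x - \<phi> y\<bar> \<le> H"
proof -
  have "torus_dist d x y powr \<alpha> \<le> 1 powr \<alpha>"
    using assms by (intro powr_mono2 torus_dist_le_one torus_dist_nonneg) auto
  then have "H * torus_dist d x y powr \<alpha> \<le> H * 1"
    using assms by (intro mult_left_mono) (auto simp: holder_bound_def)
  then show ?thesis using holder_boundD[OF assms(1,4,5)] by simp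
qed

text \<open>A section of \<open>to_circle\<close> with values in \<open>[0,1)\<close>;
  \<open>frac\<close> is applied because \<open>rep_circle\<close> returns an arbitrary
  representative. It supplies the grid cells below and the boxes of the pigeonhole argument.\<close>

definition circle_frac :: "circle \<Rightarrow> real" where
  "circle_frac x = frac (rep_circle x)"

lemma circle_frac_bounds: "0 \<le> circle_frac x" "circle_frac x < 1"
  by (simp_all add: circle_frac_def frac_lt_1)

lemma to_circle_circle_frac [simp]: "to_circle (circle_frac x) = x"
proof -
  have "to_circle (rep_circle x) = x"
    by (metis Quotient_circle Quotient_abs_rep)
  then show ?thesis
    using to_circle_of_int_add[of "circle_frac x" "\<lfloor>rep_circle x\<rfloor>"]
    by (simp add: circle_frac_def frac_def)
qed

lemma circle_frac_to_circle:
  assumes "0 \<le> t" "t < 1"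
  shows "circle_frac (to_circle t) = t"
proof -
  have "circle_frac (to_circle t) - t \<in> \<int>"
    using circle.abs_eq_iff[of "circle_frac (to_circle t)" t] by simp
  then obtain n where "circle_frac (to_circle t) - t = of_int n"
    by (elim Ints_cases)
  moreover have "n = 0"
    using calculation assms circle_frac_bounds[of "to_circle t"] by linarith
  ultimately show ?thesis by simp
qed

text \<open>The section jumps at 0, so continuity cannot be used. Its sublevel sets for levels in
  \<open>[0,1)\<close> are images of compact intervals under \<open>to_circle\<close>, hence
  closed.\<close>

lemma measurable_circle_frac [measurable]: "circle_frac \<in> borel_measurable borel"
proof (rule borel_measurable_iff_le[THEN iffD2], intro allI)
  fix a :: real
  consider "a < 0" | "0 \<le> a" "a < 1" | "1 \<le> a" by linarith
  then show "{x \<in> space borel. circle_frac x \<le> a} \<in> sets borel"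
  proof cases
    case 1
    then have "{x \<in> space borel. circle_frac x \<le> a} = {}"
      using circle_frac_bounds(1) by (auto simp: not_le intro: less_le_trans)
    then show ?thesis by simp
  next
    case 2
    have "{x \<in> space borel. circle_frac x \<le> a} = to_circle ` {0..a}"
    proof (intro equalityI subsetI)
      fix x assume "x \<in> {x \<in> space borel. circle_frac x \<le> a}"
      then show "x \<in> to_circle ` {0..a}"
        using circle_frac_bounds(1)[of x] by (intro image_eqI[of _ _ "circle_frac x"]) auto
    qed (use 2 in \<open>auto simp: circle_frac_to_circle\<close>)
    moreover have "compact (to_circle ` {0..a})"
      by (intro compact_continuous_image continuous_to_circle) simp
    ultimately show ?thesis by (simp add: compact_imp_closed)
  next
    case 3
    then have "{x \<in> space borel. circle_frac x \<le> a} = UNIV"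
      using circle_frac_bounds(2) by (auto intro: less_imp_le less_le_trans)
    then show ?thesis by simp
  qed
qed

text \<open>Measurability for the product sigma-algebra is obtained from a pointwise limit of step
  functions: \<open>\<phi>n n\<close> takes on each grid cell of side \<open>1/(n+1)\<close> the
  value of \<open>\<phi>\<close> at the corner of that cell.\<close>

lemma measurable_holder_bound:
  assumes "d \<ge> 1" "0 < \<alpha>" and \<phi>: "holder_bound d \<alpha> H \<phi>"
  shows "\<phi> \<in> borel_measurable (torus_haar d)"
proof (rule borel_measurable_LIMSEQ_real)
  define cell where "cell n x = \<lfloor>real (Suc n) * circle_frac x\<rfloor>" for n x
  define pt :: "nat \<Rightarrow> (nat \<Rightarrow> int) \<Rightarrow> nat \<Rightarrow> circle"
    where "pt n h = (\<lambda>j\<in>{..<d}. to_circle (of_int (h j) / real (Suc n)))" for n h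
  \<comment> \<open>For each \<open>x\<close> the product of indicators picks out one grid index
    \<open>h\<close>. In this form every summand is a constant times a product of functions of one
    coordinate.\<close>
  define \<phi>n where "\<phi>n n x = (\<Sum>h\<in>(\<Pi>\<^sub>E j\<in>{..<d}. {0..<int (Suc n)}).
      \<phi> (pt n h) * (\<Prod>j<d. of_bool (cell n (x j) = h j)))" for n x
  have cell_range: "cell n x \<in> {0..<int (Suc n)}" for n x
  proof -
    have "real (Suc n) * circle_frac x < real (Suc n) * 1"
      using circle_frac_bounds[of x] by (intro mult_strict_left_mono) auto
    then show ?thesis
      using circle_frac_bounds[of x] by (simp add: cell_def floor_less_iff)
  qed
  have \<phi>n_eq: "\<phi>n n x = \<phi> (pt n (\<lambda>j\<in>{..<d}. cell n (x j)))" if "x \<in> torus d" for n x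
  proof -
    let ?h = "\<lambda>j\<in>{..<d}. cell n (x j)"
    have "(\<Prod>j<d. of_bool (cell n (x j) = h j)) = (of_bool (h = ?h) :: real)"
      if h: "h \<in> (\<Pi>\<^sub>E j\<in>{..<d}. {0..<int (Suc n)})" for h
    proof (cases "h = ?h")
      case False
      have "\<exists>j<d. cell n (x j) \<noteq> h j"
      proof (rule ccontr)
        assume "\<not> ?thesis"
        then have "h j = ?h j" for j
          using PiE_arb[OF h, of j] by (cases "j < d") simp_all
        then show False using False by blast
      qed
      then have "(\<Prod>j<d. of_bool (cell n (x j) = h j)) = (0 :: real)"
        by (intro prod_zero) auto
      then show ?thesis using False by simp
    qed simp
    then have "\<phi>n n x = (\<Sum>h\<in>(\<Pi>\<^sub>E j\<in>{..<d}. {0..<int (Suc n)}). \<phi> (pt n h) * of_bool (h = ?h))"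
      unfolding \<phi>n_def by (intro sum.cong) auto
    also have "\<dots> = \<phi> (pt n ?h)"
    proof -
      have "?h \<in> (\<Pi>\<^sub>E j\<in>{..<d}. {0..<int (Suc n)})"
        using cell_range by auto
      then show ?thesis
        by (simp add: of_bool_def if_distrib finite_PiE cong: if_cong)
    qed
    finally show ?thesis .
  qed
  show "\<phi>n n \<in> borel_measurable (torus_haar d)" for n
  proof -
    have "(\<lambda>x. of_bool (cell n (x j) = i) :: real) \<in> borel_measurable (torus_haar d)" if "j < d" for j i
    proof -
      have "(\<lambda>x. of_bool (cell n x = i) :: real) \<in> borel_measurable borel"
        unfolding cell_def of_bool_def by measurable
      then show ?thesis using that by (rule measurable_torus_component[rotated])
    qed
    then show ?thesis
      unfolding \<phi>n_def[abs_def]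
      by (intro borel_measurable_sum borel_measurable_times borel_measurable_prod) auto
  qed
  show "(\<lambda>n. \<phi>n n x) \<longlonglongrightarrow> \<phi> x" if "x \<in> space (torus_haar d)" for x
  proof -
    have x: "x \<in> torus d" using that by (simp add: space_torus_haar)
    have H: "0 \<le> H" using \<phi> by (simp add: holder_bound_def)
    let ?y = "\<lambda>n. pt n (\<lambda>j\<in>{..<d}. cell n (x j))"
    have dist: "torus_dist d (?y n) x \<le> inverse (real (Suc n))" for n
    proof -
      obtain j where j: "j < d" "torus_dist d (?y n) x = circle_norm (?y n j - x j)"
        using assms(1) by (rule torus_dist_attained)
      let ?u = "of_int (cell n (x j)) / real (Suc n)"
      have "?y n j - x j = to_circle ?u - to_circle (circle_frac (x j))"
        using j(1) by (simp add: pt_def)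
      also have "\<dots> = to_circle (?u - circle_frac (x j))"
        by transfer simp
      finally have "torus_dist d (?y n) x \<le> \<bar>?u - circle_frac (x j)\<bar>"
        using circle_norm_to_circle_le j(2) by simp
      also have "\<dots> = \<bar>of_int (cell n (x j)) - real (Suc n) * circle_frac (x j)\<bar> / real (Suc n)"
        by (simp add: field_simps)
      also have "\<dots> \<le> 1 / real (Suc n)"
        unfolding cell_def by (intro divide_right_mono) linarith+
      finally show ?thesis by (simp add: inverse_eq_divide)
    qed
    have "\<bar>\<phi>n n x - \<phi> x\<bar> \<le> H * inverse (real (Suc n)) powr \<alpha>" for n
    proof -
      have "?y n \<in> torus d" by (simp add: pt_def torus_def)
      then have "\<bar>\<phi>n n x - \<phi> x\<bar> \<le> H * torus_dist d (?y n) x powr \<alpha>"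
        using \<phi> x by (simp add: \<phi>n_eq holder_boundD)
      also have "\<dots> \<le> H * inverse (real (Suc n)) powr \<alpha>"
        using assms H dist by (intro mult_left_mono powr_mono2 torus_dist_nonneg) auto
      finally show ?thesis .
    qed
    then have le: "\<forall>\<^sub>F n in sequentially. norm (\<phi>n n x - \<phi> x) \<le> H * inverse (real (Suc n)) powr \<alpha>"
      unfolding real_norm_def by (intro always_eventually allI)
    have "(\<lambda>n. H * inverse (real (Suc n)) powr \<alpha>) \<longlonglongrightarrow> H * 0"
      using assms
      by (intro tendsto_mult tendsto_const tendsto_zero_powrI[OF LIMSEQ_inverse_real_of_nat tendsto_const]) auto
    then have "(\<lambda>n. \<phi>n n x - \<phi> x) \<longlonglongrightarrow> 0"
      unfolding mult_zero_right by (rule Lim_null_comparison[OF le])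
    then show ?thesis by (rule LIM_zero_cancel)
  qed
qed

section \<open>Bounded integrands and the decay of Fourier coefficients\<close>

lemma integrable_torus_bounded:
  fixes f :: "(nat \<Rightarrow> circle) \<Rightarrow> 'b :: {banach, second_countable_topology}"
  assumes "f \<in> borel_measurable (torus_haar d)" "\<And>x. x \<in> torus d \<Longrightarrow> norm (f x) \<le> B"
  shows "integrable (torus_haar d) f"
  using assms by (intro torus_haar.integrable_const_bound[where B = B]) (auto simp: space_torus_haar)

lemma norm_torus_integral_le:
  fixes f :: "(nat \<Rightarrow> circle) \<Rightarrow> 'b :: {banach, second_countable_topology}"
  assumes "\<And>x. x \<in> torus d \<Longrightarrow> norm (f x) \<le> B" "0 \<le> B"
  shows "norm (\<integral>x. f x \<partial>torus_haar d) \<le> B"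
proof -
  have "norm (\<integral>x. f x \<partial>torus_haar d) \<le> (\<integral>x. norm (f x) \<partial>torus_haar d)"
    by (rule integral_norm_bound)
  also have "\<dots> \<le> (\<integral>x. B \<partial>torus_haar d)"
    using assms by (intro integral_mono') (auto simp: space_torus_haar)
  finally show ?thesis by (simp add: torus_haar.prob_space)
qed

lemma holder_bound_bounded:
  assumes "d \<ge> 1" "0 < \<alpha>" "holder_bound d \<alpha> H \<phi>"
  obtains B where "\<And>x. x \<in> torus d \<Longrightarrow> \<bar>\<phi> x\<bar> \<le> B"
proof -
  obtain y where "y \<in> torus d" using torus_not_empty by blast
  then have "\<bar>\<phi> x\<bar> \<le> \<bar>\<phi> y\<bar> + H" if "x \<in> torus d" for x
    using holder_bound_oscillation[OF assms(3,1,2) that, of y] by linarith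
  then show ?thesis by (rule that)
qed

text \<open>A half-period shift makes twice the coefficient an integral against
  \<open>\<phi>\<close> minus its translate. Shifting only the coordinate where
  \<open>\<bar>k j\<bar>\<close> is largest moves points by at most \<open>1/\<bar>k\<bar>\<close>
  and keeps the bound free of \<open>d\<close>. Spare factors of 2 are dropped.\<close>

lemma fourier_coefficient_decay:
  assumes "d \<ge> 1" "0 < \<alpha>" and \<phi>: "holder_bound d \<alpha> H \<phi>" and k: "\<exists>j<d. k j \<noteq> 0"
  shows "cmod (\<integral>y. of_real (\<phi> y) * circle_cis (freq_dot d k y) \<partial>torus_haar d)
    \<le> H * (1 / real_of_int (freq_norm d k)) powr \<alpha>"
proof -
  let ?F = "\<integral>y. of_real (\<phi> y) * circle_cis (freq_dot d k y) \<partial>torus_haar d"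
  have [measurable]: "\<phi> \<in> borel_measurable (torus_haar d)"
    using assms by (intro measurable_holder_bound)
  obtain B where B: "\<And>x. x \<in> torus d \<Longrightarrow> \<bar>\<phi> x\<bar> \<le> B"
    using assms by (metis holder_bound_bounded)
  obtain j0 where j0: "j0 < d" "freq_norm d k = \<bar>k j0\<bar>"
    using assms(1) by (rule freq_norm_attained)
  obtain j1 where j1: "j1 < d" "k j1 \<noteq> 0" using k by blast
  have n_pos: "0 < freq_norm d k" by (rule freq_norm_pos) fact+
  have k_j0: "k j0 \<noteq> 0" using n_pos j0 by simp
  \<comment> \<open>translation by half a period, which flips the sign of the character\<close>
  define c where "c = (\<lambda>j. if j = j0 then to_circle (1 / (2 * of_int (k j0))) else 0)"
  have "freq_dot d k c = circle_scale (k j0) (to_circle (1 / (2 * of_int (k j0))))"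
    unfolding freq_dot_def c_def using j0(1) by (simp add: if_distrib cong: if_cong)
  then have flip: "circle_cis (freq_dot d k c) = - 1"
    using k_j0 by (simp add: circle_scale_half_period)
  have T [measurable]: "translation d c \<in> measurable (torus_haar d) (torus_haar d)"
    by (rule measurable_translation)
  have "?F = (\<integral>y. of_real (\<phi> (translation d c y)) * circle_cis (freq_dot d k (translation d c y)) \<partial>torus_haar d)"
    by (rule integral_torus_translate[symmetric]) measurable
  also have "\<dots> = - (\<integral>y. of_real (\<phi> (translation d c y)) * circle_cis (freq_dot d k y) \<partial>torus_haar d)"
    by (simp add: freq_dot_translation circle_cis_add flip)
  finally have "2 * ?F = ?F - (\<integral>y. of_real (\<phi> (translation d c y)) * circle_cis (freq_dot d k y) \<partial>torus_haar d)"
    by simp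
  also have "\<dots> = (\<integral>y. of_real (\<phi> y) * circle_cis (freq_dot d k y)
      - of_real (\<phi> (translation d c y)) * circle_cis (freq_dot d k y) \<partial>torus_haar d)"
    by (rule Bochner_Integration.integral_diff[symmetric]; rule integrable_torus_bounded[where B = B])
      (use B in \<open>auto simp: norm_mult\<close>)
  finally have eq: "2 * ?F = (\<integral>y. of_real (\<phi> y) * circle_cis (freq_dot d k y)
      - of_real (\<phi> (translation d c y)) * circle_cis (freq_dot d k y) \<partial>torus_haar d)" .
  have dist: "torus_dist d y (translation d c y) \<le> 1 / real_of_int (freq_norm d k)" for y
  proof -
    obtain j where j: "j < d" "torus_dist d y (translation d c y) = circle_norm (y j - translation d c y j)"
      using assms(1) by (rule torus_dist_attained)
    have "torus_dist d y (translation d c y) = circle_norm (c j)"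
      using j by (simp add: translation_def circle_norm_minus)
    also have "\<dots> \<le> \<bar>1 / (2 * of_int (k j0))\<bar>"
      using circle_norm_to_circle_le[of "1 / (2 * of_int (k j0))"] by (simp add: c_def)
    also have "\<dots> \<le> 1 / real_of_int (freq_norm d k)"
      using k_j0 by (simp add: j0(2) abs_mult field_simps)
    finally show ?thesis .
  qed
  have "cmod (2 * ?F) \<le> H * (1 / real_of_int (freq_norm d k)) powr \<alpha>"
    unfolding eq
  proof (rule norm_torus_integral_le)
    fix y assume y: "y \<in> torus d"
    have "cmod (of_real (\<phi> y) * circle_cis (freq_dot d k y) - of_real (\<phi> (translation d c y)) * circle_cis (freq_dot d k y))
        = \<bar>\<phi> y - \<phi> (translation d c y)\<bar>"
      by (simp add: norm_mult flip: left_diff_distrib of_real_diff)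
    also have "\<dots> \<le> H * torus_dist d y (translation d c y) powr \<alpha>"
      using \<phi> y by (intro holder_boundD) auto
    also have "\<dots> \<le> H * (1 / real_of_int (freq_norm d k)) powr \<alpha>"
      using assms dist by (intro mult_left_mono powr_mono2 torus_dist_nonneg) (auto simp: holder_bound_def)
    finally show "cmod (of_real (\<phi> y) * circle_cis (freq_dot d k y) - of_real (\<phi> (translation d c y)) * circle_cis (freq_dot d k y))
        \<le> H * (1 / real_of_int (freq_norm d k)) powr \<alpha>" .
  qed (use \<phi> in \<open>simp add: holder_bound_def\<close>)
  then have "2 * cmod ?F \<le> H * (1 / real_of_int (freq_norm d k)) powr \<alpha>"
    by (simp add: norm_mult)
  then show ?thesis using norm_ge_zero[of ?F] by linarith
qed

section \<open>Smoothing and Birkhoff sums\<close>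

text \<open>A product of one-variable kernels: the integrals factor by Fubini, and the nonnegative
  weights multiply, so the mass picks up no factor beyond the \<open>d\<close>-th power.\<close>

lemma torus_jackson_kernel:
  fixes m d :: nat
  assumes "m > 0"
  obtains Q :: "(nat \<Rightarrow> nat \<times> nat) set" and W :: "(nat \<Rightarrow> nat \<times> nat) \<Rightarrow> real"
    and k :: "(nat \<Rightarrow> nat \<times> nat) \<Rightarrow> nat \<Rightarrow> int" and K :: "(nat \<Rightarrow> circle) \<Rightarrow> real"
  where "finite Q" "\<forall>q. 0 \<le> W q" "(\<Sum>q\<in>Q. W q) \<le> (2 * real m) ^ d"
    "\<forall>q\<in>Q. \<forall>j<d. \<bar>k q j\<bar> \<le> 2 * int m"
    "\<forall>y. complex_of_real (K y) = (\<Sum>q\<in>Q. of_real (W q) * circle_cis (freq_dot d (k q) y))"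
    "\<forall>y. 0 \<le> K y" "K \<in> borel_measurable (torus_haar d)" "(\<integral>y. K y \<partial>torus_haar d) = 1"
    "\<forall>j<d. (\<integral>y. K y * (circle_norm (y j))\<^sup>2 \<partial>torus_haar d) \<le> 1 / (real m)\<^sup>2"
proof -
  obtain P :: "(nat \<times> nat) set" and w :: "nat \<times> nat \<Rightarrow> real" and \<kappa> :: "nat \<times> nat \<Rightarrow> int"
      and K1 :: "circle \<Rightarrow> real"
    where P: "finite P" and w [rule_format]: "\<forall>p. 0 \<le> w p" and w_sum: "(\<Sum>p\<in>P. w p) \<le> 2 * real m"
      and \<kappa> [rule_format]: "\<forall>p\<in>P. \<bar>\<kappa> p\<bar> \<le> 2 * int m"
      and expansion [rule_format]: "\<forall>x. complex_of_real (K1 x) = (\<Sum>p\<in>P. of_real (w p) * circle_cis (circle_scale (\<kappa> p) x))"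
      and K1_nonneg [rule_format]: "\<forall>x. 0 \<le> K1 x" and K1_meas [measurable]: "K1 \<in> borel_measurable borel"
      and K1_total: "(\<integral>x. K1 x \<partial>circle_haar) = 1"
      and K1_moment: "(\<integral>x. K1 x * (circle_norm x)\<^sup>2 \<partial>circle_haar) \<le> 1 / (real m)\<^sup>2"
    by (rule jackson_kernel[OF assms])
  define Q where "Q = ({..<d} \<rightarrow>\<^sub>E P)"
  define W where "W q = (\<Prod>j<d. w (q j))" for q :: "nat \<Rightarrow> nat \<times> nat"
  define k where "k q j = \<kappa> (q j)" for q :: "nat \<Rightarrow> nat \<times> nat" and j
  define K where "K y = (\<Prod>j<d. K1 (y j))" for y :: "nat \<Rightarrow> circle"
  have K1_le: "K1 x \<le> (\<Sum>p\<in>P. w p)" for x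
  proof -
    have "K1 x = cmod (complex_of_real (K1 x))" using K1_nonneg by simp
    also have "\<dots> \<le> (\<Sum>p\<in>P. w p)"
      unfolding expansion using w by (intro sum_norm_le) (simp add: norm_mult)
    finally show ?thesis .
  qed
  have int: "integrable circle_haar (\<lambda>x. K1 x * g x)"
    if [measurable]: "g \<in> borel_measurable borel" and g: "\<And>x. \<bar>g x\<bar> \<le> 1" for g
  proof (rule circle_haar.integrable_const_bound[where B = "\<Sum>p\<in>P. w p"])
    have "K1 x * \<bar>g x\<bar> \<le> (\<Sum>p\<in>P. w p) * 1" for x
      using K1_le[of x] g[of x] w by (intro mult_mono sum_nonneg) auto
    then show "AE x in circle_haar. norm (K1 x * g x) \<le> (\<Sum>p\<in>P. w p)"
      using K1_nonneg by (simp add: abs_mult)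
  qed measurable
  have "(\<Sum>q\<in>Q. W q) = (\<Sum>p\<in>P. w p) ^ d"
    unfolding Q_def W_def using prod_sum_PiE[of "{..<d}" "\<lambda>_. P" "\<lambda>_. w"] P by simp
  also have "\<dots> \<le> (2 * real m) ^ d"
    using w_sum w by (intro power_mono sum_nonneg) auto
  finally have W_sum: "(\<Sum>q\<in>Q. W q) \<le> (2 * real m) ^ d" .
  have K_expansion: "complex_of_real (K y) = (\<Sum>q\<in>Q. of_real (W q) * circle_cis (freq_dot d (k q) y))" for y
  proof -
    have "complex_of_real (K y) = (\<Prod>j<d. \<Sum>p\<in>P. of_real (w p) * circle_cis (circle_scale (\<kappa> p) (y j)))"
      by (simp only: K_def of_real_prod expansion)
    also have "\<dots> = (\<Sum>q\<in>Q. \<Prod>j<d. of_real (w (q j)) * circle_cis (circle_scale (\<kappa> (q j)) (y j)))"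
      unfolding Q_def using P by (intro prod_sum_PiE) auto
    also have "\<dots> = (\<Sum>q\<in>Q. of_real (W q) * circle_cis (freq_dot d (k q) y))"
      by (simp only: prod.distrib W_def k_def freq_dot_def circle_cis_sum of_real_prod)
    finally show ?thesis .
  qed
  have K_meas: "K \<in> borel_measurable (torus_haar d)"
    unfolding K_def[abs_def] by (intro borel_measurable_prod measurable_torus_component K1_meas) simp
  have "(\<integral>y. K y \<partial>torus_haar d) = (\<Prod>j<d. \<integral>x. K1 x \<partial>circle_haar)"
    unfolding K_def torus_haar_def using int[of "\<lambda>_. 1"]
    by (intro circle_product.product_integral_prod) auto
  then have K_total: "(\<integral>y. K y \<partial>torus_haar d) = 1" by (simp add: K1_total)
  have K_moment: "(\<integral>y. K y * (circle_norm (y l))\<^sup>2 \<partial>torus_haar d) \<le> 1 / (real m)\<^sup>2" if l: "l < d" for l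
  proof -
    \<comment> \<open>The weight is spread as a product over all coordinates so that the integral
      factors; every coordinate other than \<open>l\<close> then contributes 1.\<close>
    define g where "g j x = (if j = l then (circle_norm x)\<^sup>2 else 1)" for j :: nat and x
    have "(\<Prod>j<d. g j (y j)) = (circle_norm (y l))\<^sup>2" for y
      unfolding g_def using l by (simp add: prod.delta)
    then have "(\<integral>y. K y * (circle_norm (y l))\<^sup>2 \<partial>torus_haar d)
        = (\<integral>y. (\<Prod>j<d. K1 (y j) * g j (y j)) \<partial>torus_haar d)"
      by (simp add: K_def prod.distrib)
    also have "\<dots> = (\<Prod>j<d. \<integral>x. K1 x * g j x \<partial>circle_haar)"
    proof -
      have "\<bar>g j x\<bar> \<le> 1" for j x
        using circle_norm_le_half[of x] by (simp add: g_def power_le_one)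
      moreover have "g j \<in> borel_measurable borel" for j
        unfolding g_def by (cases "j = l") simp_all
      ultimately show ?thesis
        unfolding torus_haar_def by (intro circle_product.product_integral_prod int) auto
    qed
    also have "\<dots> = (\<Prod>j<d. if j = l then \<integral>x. K1 x * (circle_norm x)\<^sup>2 \<partial>circle_haar else 1)"
      by (intro prod.cong) (auto simp: g_def K1_total)
    also have "\<dots> = (\<integral>x. K1 x * (circle_norm x)\<^sup>2 \<partial>circle_haar)"
      using l by (simp add: prod.delta)
    finally show ?thesis using K1_moment by simp
  qed
  show ?thesis
  proof (rule that)
    show "finite Q" using P by (simp add: Q_def finite_PiE)
    show "\<forall>q. 0 \<le> W q" by (simp add: W_def w prod_nonneg)
    show "\<forall>q\<in>Q. \<forall>j<d. \<bar>k q j\<bar> \<le> 2 * int m"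
      using \<kappa> by (auto simp: k_def Q_def PiE_iff)
    show "\<forall>y. 0 \<le> K y" by (simp add: K_def K1_nonneg prod_nonneg)
  qed (use W_sum K_expansion K_meas K_total K_moment in blast)+
qed

text \<open>Lets the second moment of the kernel control its moment of order
  \<open>\<alpha>\<close>.\<close>

lemma powr_le_one_plus_square:
  fixes s :: real
  assumes "0 \<le> s" "0 < \<alpha>" "\<alpha> \<le> 1"
  shows "s powr \<alpha> \<le> 1 + s\<^sup>2"
proof (cases "s \<le> 1")
  case True
  then have "s powr \<alpha> \<le> 1 powr \<alpha>" using assms by (intro powr_mono2) auto
  then show ?thesis by (simp add: add_increasing2)
next
  case False
  then have "s powr \<alpha> \<le> s powr 2" using assms by (intro powr_mono) auto
  then show ?thesis using False by simp
qed

text \<open>The parameter \<open>h\<close> is a length scale. At \<open>h = 1/m\<close>, the width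
  of the kernel, each of the \<open>d\<close> summands integrates to at most \<open>h^2\<close>, so
  the bracket becomes \<open>1 + d\<close>.\<close>

lemma torus_dist_powr_le:
  assumes "d \<ge> 1" "0 < \<alpha>" "\<alpha> \<le> 1" "0 < h"
  shows "torus_dist d x y powr \<alpha> \<le> h powr \<alpha> * (1 + (\<Sum>j<d. (circle_norm (x j - y j))\<^sup>2) / h\<^sup>2)"
proof -
  obtain j where j: "j < d" "torus_dist d x y = circle_norm (x j - y j)"
    using assms(1) by (rule torus_dist_attained)
  let ?t = "torus_dist d x y"
  have "?t\<^sup>2 \<le> (\<Sum>j<d. (circle_norm (x j - y j))\<^sup>2)"
    unfolding j(2) using j(1) member_le_sum[of j "{..<d}" "\<lambda>j. (circle_norm (x j - y j))\<^sup>2"] by simp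
  then have "(?t / h)\<^sup>2 \<le> (\<Sum>j<d. (circle_norm (x j - y j))\<^sup>2) / h\<^sup>2"
    unfolding power_divide by (intro divide_right_mono) auto
  moreover have "(?t / h) powr \<alpha> \<le> 1 + (?t / h)\<^sup>2"
    using assms torus_dist_nonneg[of d x y] by (intro powr_le_one_plus_square) auto
  ultimately have "h powr \<alpha> * (?t / h) powr \<alpha> \<le> h powr \<alpha> * (1 + (\<Sum>j<d. (circle_norm (x j - y j))\<^sup>2) / h\<^sup>2)"
    by (intro mult_left_mono) auto
  moreover have "h powr \<alpha> * (?t / h) powr \<alpha> = ?t powr \<alpha>"
    using assms torus_dist_nonneg[of d x y] by (simp flip: powr_mult)
  ultimately show ?thesis by simp
qed

lemma smoothing_error:
  assumes "d \<ge> 1" "0 < \<alpha>" "\<alpha> \<le> 1" "m > 0" and \<psi>: "holder_bound d \<alpha> H \<psi>" and x: "x \<in> torus d"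
    and K: "integrable (torus_haar d) K" "\<And>y. 0 \<le> K y" "(\<integral>y. K y \<partial>torus_haar d) = 1"
    and moment: "\<And>j. j < d \<Longrightarrow> (\<integral>y. K y * (circle_norm (y j))\<^sup>2 \<partial>torus_haar d) \<le> 1 / (real m)\<^sup>2"
  shows "\<bar>\<psi> x - (\<integral>y. \<psi> (translation d x y) * K y \<partial>torus_haar d)\<bar> \<le> H * (1 / real m) powr \<alpha> * (1 + real d)"
proof -
  have H: "0 \<le> H" using \<psi> by (simp add: holder_bound_def)
  have [measurable]: "\<psi> \<in> borel_measurable (torus_haar d)"
    using assms by (intro measurable_holder_bound)
  have [measurable]: "translation d x \<in> measurable (torus_haar d) (torus_haar d)"
    by (rule measurable_translation)
  have [measurable]: "K \<in> borel_measurable (torus_haar d)" using K(1) by simp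
  obtain B where B: "\<And>x. x \<in> torus d \<Longrightarrow> \<bar>\<psi> x\<bar> \<le> B"
    using assms by (metis holder_bound_bounded)
  have B0: "0 \<le> B" using B[OF x] by linarith
  have int: "integrable (torus_haar d) (\<lambda>y. f y * K y)"
    if [measurable]: "f \<in> borel_measurable (torus_haar d)" and f: "\<And>y. y \<in> torus d \<Longrightarrow> \<bar>f y\<bar> \<le> c" for f c
  proof (rule Bochner_Integration.integrable_bound[OF integrable_mult_right[OF K(1), of c]])
    show "AE y in torus_haar d. norm (f y * K y) \<le> norm (c * K y)"
      using f K(2) by (intro AE_I2) (auto simp: space_torus_haar abs_mult intro!: mult_right_mono intro: order_trans[OF _ abs_ge_self])
  qed measurable
  have meas_norm: "(\<lambda>y. (circle_norm (y j))\<^sup>2) \<in> borel_measurable (torus_haar d)" if "j < d" for j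
    using that by (intro borel_measurable_power measurable_torus_component measurable_circle_norm)
  have int_norm: "integrable (torus_haar d) (\<lambda>y. K y * (circle_norm (y j))\<^sup>2)" if "j < d" for j
    unfolding mult.commute[of "K _"] using that circle_norm_le_half
    by (intro int[where c = 1] meas_norm) (simp_all add: power_le_one order_trans[OF circle_norm_le_half])
  define h where "h = 1 / real m"
  have h: "0 < h" using assms by (simp add: h_def)
  let ?G = "\<lambda>y. H * h powr \<alpha> * (K y + (\<Sum>j<d. K y * (circle_norm (y j))\<^sup>2) / h\<^sup>2)"
  have sum_int: "integrable (torus_haar d) (\<lambda>y. (\<Sum>j<d. K y * (circle_norm (y j))\<^sup>2) / h\<^sup>2)"
    using int_norm by (intro integrable_divide Bochner_Integration.integrable_sum) auto
  then have G_int: "integrable (torus_haar d) ?G"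
    using K(1) by (intro integrable_mult_right Bochner_Integration.integrable_add)
  \<comment> \<open>Since \<open>K\<close> has integral 1, the constant \<open>\<psi> x\<close> can
    be moved under the integral.\<close>
  have "\<psi> x - (\<integral>y. \<psi> (translation d x y) * K y \<partial>torus_haar d)
      = (\<integral>y. \<psi> x * K y \<partial>torus_haar d) - (\<integral>y. \<psi> (translation d x y) * K y \<partial>torus_haar d)"
    by (simp add: K(3))
  also have "\<dots> = (\<integral>y. \<psi> x * K y - \<psi> (translation d x y) * K y \<partial>torus_haar d)"
    using B x by (intro Bochner_Integration.integral_diff[symmetric] int[where c = B]) auto
  finally have "\<bar>\<psi> x - (\<integral>y. \<psi> (translation d x y) * K y \<partial>torus_haar d)\<bar>
      \<le> (\<integral>y. norm (\<psi> x * K y - \<psi> (translation d x y) * K y) \<partial>torus_haar d)"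
    using integral_norm_bound[of "torus_haar d" "\<lambda>y. \<psi> x * K y - \<psi> (translation d x y) * K y"]
    by (simp only: real_norm_def)
  also have "\<dots> \<le> (\<integral>y. ?G y \<partial>torus_haar d)"
  proof (rule integral_mono'[OF G_int])
    fix y assume "y \<in> space (torus_haar d)"
    have "\<bar>\<psi> x - \<psi> (translation d x y)\<bar> \<le> H * torus_dist d x (translation d x y) powr \<alpha>"
      using \<psi> x by (intro holder_boundD) auto
    also have "\<dots> \<le> H * (h powr \<alpha> * (1 + (\<Sum>j<d. (circle_norm (x j - translation d x y j))\<^sup>2) / h\<^sup>2))"
      using assms H h by (intro mult_left_mono torus_dist_powr_le)
    also have "(\<Sum>j<d. (circle_norm (x j - translation d x y j))\<^sup>2) = (\<Sum>j<d. (circle_norm (y j))\<^sup>2)"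
      by (intro sum.cong) (auto simp: translation_def circle_norm_minus)
    finally have "\<bar>\<psi> x - \<psi> (translation d x y)\<bar> * K y
        \<le> H * (h powr \<alpha> * (1 + (\<Sum>j<d. (circle_norm (y j))\<^sup>2) / h\<^sup>2)) * K y"
      using K(2) by (rule mult_right_mono)
    also have "\<dots> = ?G y"
      by (simp add: algebra_simps sum_distrib_left)
    finally show "norm (\<psi> x * K y - \<psi> (translation d x y) * K y) \<le> ?G y"
      using K(2)[of y] by (simp add: abs_mult flip: left_diff_distrib)
  next
    fix y show "0 \<le> ?G y" using H K(2) by (intro mult_nonneg_nonneg add_nonneg_nonneg divide_nonneg_nonneg sum_nonneg) auto
  qed
  also have "\<dots> = H * h powr \<alpha> * (1 + (\<Sum>j<d. \<integral>y. K y * (circle_norm (y j))\<^sup>2 \<partial>torus_haar d) / h\<^sup>2)"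
  proof -
    have "(\<integral>y. (\<Sum>j<d. K y * (circle_norm (y j))\<^sup>2) \<partial>torus_haar d)
        = (\<Sum>j<d. \<integral>y. K y * (circle_norm (y j))\<^sup>2 \<partial>torus_haar d)"
      using int_norm by (intro Bochner_Integration.integral_sum) simp
    then show ?thesis
      using K(1,3) sum_int
      by (simp only: integral_mult_right_zero Bochner_Integration.integral_add integral_divide_zero)
  qed
  also have "\<dots> \<le> H * h powr \<alpha> * (1 + (\<Sum>j<d. h\<^sup>2) / h\<^sup>2)"
    using H moment by (intro mult_left_mono add_left_mono divide_right_mono sum_mono) (auto simp: h_def power_divide)
  also have "(\<Sum>j<d. h\<^sup>2) / h\<^sup>2 = real d" using h by simp
  finally show ?thesis by (simp add: h_def)
qed

text \<open>The bound is independent of \<open>N\<close>; dividing by \<open>N\<close> is what makes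
  the oscillating part small.\<close>

lemma norm_character_sum_le:
  assumes "0 < circle_norm u"
  shows "cmod (\<Sum>j<N. circle_cis (circle_scale (int j) u)) \<le> 1 / circle_norm u"
proof -
  let ?z = "circle_cis u"
  have pos: "0 < cmod (?z - 1)" using circle_norm_le_dist_cis[of u] assms by linarith
  have "(?z - 1) * (\<Sum>j<N. ?z ^ j) = ?z ^ N - 1"
    by (simp add: power_diff_1_eq)
  then have "cmod (?z - 1) * cmod (\<Sum>j<N. ?z ^ j) = cmod (?z ^ N - 1)"
    by (metis norm_mult)
  also have "\<dots> \<le> 2"
    using norm_triangle_ineq4[of "?z ^ N" 1] by (simp add: norm_power)
  finally have "cmod (\<Sum>j<N. ?z ^ j) \<le> 2 / cmod (?z - 1)"
    using pos by (simp add: field_simps)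
  also have "\<dots> \<le> 2 / (2 * circle_norm u)"
    using assms circle_norm_le_dist_cis[of u] pos by (intro divide_left_mono) auto
  finally show ?thesis by (simp add: circle_cis_scale_of_nat)
qed

lemma birkhoff_kernel_estimate:
  assumes "d \<ge> 1" "0 < \<alpha>" "\<alpha> \<le> 1" "0 < \<gamma>" "\<alpha> \<le> A" "m > 0" "N > 0"
    and \<psi>: "holder_bound d \<alpha> H \<psi>" and mean: "(\<integral>y. \<psi> y \<partial>torus_haar d) = 0"
    and dio: "diophantine d \<gamma> A \<omega>" and x: "x \<in> torus d"
  shows "\<bar>1 / real N * birkhoff_sum d \<omega> \<psi> N x\<bar>
    \<le> H * (1 / real m) powr \<alpha> * (1 + real d + (2 * real m) powr (A + real d) / (\<gamma> * real N))"
proof -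
  obtain Q :: "(nat \<Rightarrow> nat \<times> nat) set" and W :: "(nat \<Rightarrow> nat \<times> nat) \<Rightarrow> real"
      and k :: "(nat \<Rightarrow> nat \<times> nat) \<Rightarrow> nat \<Rightarrow> int" and K :: "(nat \<Rightarrow> circle) \<Rightarrow> real"
    where Q: "finite Q" and W [rule_format]: "\<forall>q. 0 \<le> W q" and W_sum: "(\<Sum>q\<in>Q. W q) \<le> (2 * real m) ^ d"
      and k [rule_format]: "\<forall>q\<in>Q. \<forall>j<d. \<bar>k q j\<bar> \<le> 2 * int m"
      and expansion [rule_format]: "\<forall>y. complex_of_real (K y) = (\<Sum>q\<in>Q. of_real (W q) * circle_cis (freq_dot d (k q) y))"
      and K_nonneg [rule_format]: "\<forall>y. 0 \<le> K y" and K_meas [measurable]: "K \<in> borel_measurable (torus_haar d)"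
      and K_total: "(\<integral>y. K y \<partial>torus_haar d) = 1"
      and moment [rule_format]: "\<forall>j<d. (\<integral>y. K y * (circle_norm (y j))\<^sup>2 \<partial>torus_haar d) \<le> 1 / (real m)\<^sup>2"
    by (rule torus_jackson_kernel[OF \<open>m > 0\<close>, of d])
  have H: "0 \<le> H" using \<psi> by (simp add: holder_bound_def)
  have \<psi>_meas [measurable]: "\<psi> \<in> borel_measurable (torus_haar d)"
    using assms by (intro measurable_holder_bound)
  obtain B where B: "\<And>x. x \<in> torus d \<Longrightarrow> \<bar>\<psi> x\<bar> \<le> B"
    using assms by (metis holder_bound_bounded)
  \<comment> \<open>The Bochner integral of a nonintegrable function is 0, so an integral equal to 1
    already yields integrability.\<close>
  have K_int: "integrable (torus_haar d) K"
    using K_total not_integrable_integral_eq by force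
  define p where "p j = translation d (\<lambda>i. circle_scale (int j) (\<omega> i)) x" for j
  define S where "S z = (\<integral>y. \<psi> (translation d z y) * K y \<partial>torus_haar d)" for z
  define F where "F q = (\<integral>y. of_real (\<psi> y) * circle_cis (freq_dot d (k q) y) \<partial>torus_haar d)" for q
  define D where "D q = (\<Sum>j<N. circle_cis (circle_scale (int j) (freq_dot d (k q) \<omega>)))" for q
  have S_eq: "complex_of_real (S z) = (\<Sum>q\<in>Q. of_real (W q) * (cnj (circle_cis (freq_dot d (k q) z)) * F q))" for z
  proof -
    have [measurable]: "translation d z \<in> measurable (torus_haar d) (torus_haar d)"
      by (rule measurable_translation)
    \<comment> \<open>The smoothing integrates \<open>\<psi> (z + y) * K y\<close>, a correlation.
      Undoing the translation by \<open>z\<close> therefore leaves the conjugate of the character at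
      \<open>z\<close>.\<close>
    have shift: "(\<integral>y. of_real (\<psi> (translation d z y)) * circle_cis (freq_dot d (k q) y) \<partial>torus_haar d)
        = cnj (circle_cis (freq_dot d (k q) z)) * F q" for q
    proof -
      let ?e = "circle_cis (freq_dot d (k q) z)"
      have unit: "cnj ?e * ?e = 1"
        using complex_norm_square[of ?e] by (simp add: mult.commute)
      have "of_real (\<psi> (translation d z y)) * circle_cis (freq_dot d (k q) y)
          = cnj ?e * (of_real (\<psi> (translation d z y)) * circle_cis (freq_dot d (k q) (translation d z y)))" for y
        using unit by (simp add: freq_dot_translation circle_cis_add)
      then have "(\<integral>y. of_real (\<psi> (translation d z y)) * circle_cis (freq_dot d (k q) y) \<partial>torus_haar d)
          = cnj ?e * (\<integral>y. of_real (\<psi> (translation d z y)) * circle_cis (freq_dot d (k q) (translation d z y)) \<partial>torus_haar d)"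
        by (simp only: integral_mult_right_zero)
      also have "\<dots> = cnj ?e * F q"
        unfolding F_def by (subst integral_torus_translate) simp_all
      finally show ?thesis .
    qed
    have "complex_of_real (S z) = (\<integral>y. of_real (\<psi> (translation d z y)) * of_real (K y) \<partial>torus_haar d)"
      unfolding S_def by (simp flip: integral_complex_of_real)
    also have "\<dots> = (\<integral>y. (\<Sum>q\<in>Q. of_real (W q) * (of_real (\<psi> (translation d z y)) * circle_cis (freq_dot d (k q) y))) \<partial>torus_haar d)"
      by (simp add: expansion sum_distrib_left mult_ac)
    also have "\<dots> = (\<Sum>q\<in>Q. of_real (W q) * (\<integral>y. of_real (\<psi> (translation d z y)) * circle_cis (freq_dot d (k q) y) \<partial>torus_haar d))"
    proof (subst Bochner_Integration.integral_sum)
      fix q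
      have "integrable (torus_haar d) (\<lambda>y. of_real (\<psi> (translation d z y)) * circle_cis (freq_dot d (k q) y))"
        using B by (intro integrable_torus_bounded[where B = B]) (auto simp: norm_mult)
      then show "integrable (torus_haar d) (\<lambda>y. of_real (W q) * (of_real (\<psi> (translation d z y)) * circle_cis (freq_dot d (k q) y)))"
        by (rule integrable_mult_right)
    qed simp
    finally show ?thesis by (simp only: shift)
  qed
  have "complex_of_real (\<Sum>j<N. S (p j)) = (\<Sum>q\<in>Q. of_real (W q) * (cnj (circle_cis (freq_dot d (k q) x)) * cnj (D q) * F q))"
  proof -
    have e: "cnj (circle_cis (freq_dot d (k q) (p j)))
        = cnj (circle_cis (freq_dot d (k q) x)) * cnj (circle_cis (circle_scale (int j) (freq_dot d (k q) \<omega>)))" for q j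
      by (simp add: p_def freq_dot_translation freq_dot_scale circle_cis_add)
    have "complex_of_real (\<Sum>j<N. S (p j)) = (\<Sum>q\<in>Q. \<Sum>j<N. of_real (W q) * (cnj (circle_cis (freq_dot d (k q) (p j))) * F q))"
      unfolding of_real_sum S_eq by (rule sum.swap)
    also have "\<dots> = (\<Sum>q\<in>Q. of_real (W q) * (cnj (circle_cis (freq_dot d (k q) x)) * cnj (D q) * F q))"
      unfolding e D_def cnj_sum sum_distrib_left sum_distrib_right by (simp only: mult.assoc)
    finally show ?thesis .
  qed
  then have "\<bar>\<Sum>j<N. S (p j)\<bar> = cmod (\<Sum>q\<in>Q. of_real (W q) * (cnj (circle_cis (freq_dot d (k q) x)) * cnj (D q) * F q))"
    by (metis norm_of_real)
  also have "\<dots> \<le> (\<Sum>q\<in>Q. W q * (H * (1 / real m) powr \<alpha> * (2 * real m) powr A / \<gamma>))"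
  proof (rule sum_norm_le)
    fix q assume q: "q \<in> Q"
    have "cmod (D q) * cmod (F q) \<le> H * (1 / real m) powr \<alpha> * (2 * real m) powr A / \<gamma>"
    proof (cases "\<exists>j<d. k q j \<noteq> 0")
      \<comment> \<open>The zero frequency has no small divisor bound; it vanishes because
        \<open>\<psi>\<close> has mean zero.\<close>
      case False
      then have "freq_dot d (k q) y = 0" for y
        by (simp add: freq_dot_def circle_scale_0)
      then have "F q = 0" using mean by (simp add: F_def)
      then show ?thesis using H assms by simp
    next
      case True
      define n where "n = real_of_int (freq_norm d (k q))"
      have "0 < freq_norm d (k q)" using True by (auto intro: freq_norm_pos)
      then have n1: "1 \<le> n" by (simp add: n_def)
      obtain j where "j < d" "freq_norm d (k q) = \<bar>k q j\<bar>"
        using assms(1) by (rule freq_norm_attained)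
      then have "freq_norm d (k q) \<le> 2 * int m" using k q by simp
      then have n2: "n \<le> 2 * real m" by (simp add: n_def)
      have u: "\<gamma> / n powr A \<le> circle_norm (freq_dot d (k q) \<omega>)"
        using dio True by (auto simp: diophantine_def n_def)
      have u0: "0 < \<gamma> / n powr A" using assms n1 by simp
      have "cmod (D q) \<le> 1 / circle_norm (freq_dot d (k q) \<omega>)"
        unfolding D_def using u u0 by (intro norm_character_sum_le) linarith
      also have "\<dots> \<le> 1 / (\<gamma> / n powr A)"
        using u u0 by (intro divide_left_mono mult_pos_pos) linarith+
      finally have "cmod (D q) \<le> n powr A / \<gamma>" by simp
      moreover have "cmod (F q) \<le> H * (1 / n) powr \<alpha>"
        unfolding F_def n_def using assms True by (intro fourier_coefficient_decay) auto
      ultimately have "cmod (D q) * cmod (F q) \<le> n powr A / \<gamma> * (H * (1 / n) powr \<alpha>)"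
        using assms by (intro mult_mono) auto
      also have "\<dots> = H * n powr (A - \<alpha>) / \<gamma>"
        using n1 by (simp add: powr_diff powr_divide mult_ac)
      \<comment> \<open>Since \<open>\<alpha> \<le> A\<close>, the exponent is nonnegative and every
        frequency can be replaced by the largest possible size \<open>2 m\<close>.\<close>
      also have "\<dots> \<le> H * (2 * real m) powr (A - \<alpha>) / \<gamma>"
        using n1 n2 assms H by (intro divide_right_mono mult_left_mono powr_mono2) auto
      also have "\<dots> = H * (1 / (2 * real m)) powr \<alpha> * (2 * real m) powr A / \<gamma>"
        using assms by (simp add: powr_diff powr_divide mult_ac)
      also have "\<dots> \<le> H * (1 / real m) powr \<alpha> * (2 * real m) powr A / \<gamma>"
        using assms H by (intro divide_right_mono mult_right_mono mult_left_mono powr_mono2) (auto simp: field_simps)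
      finally show ?thesis .
    qed
    then have "W q * (cmod (D q) * cmod (F q)) \<le> W q * (H * (1 / real m) powr \<alpha> * (2 * real m) powr A / \<gamma>)"
      using W by (intro mult_left_mono)
    then show "cmod (of_real (W q) * (cnj (circle_cis (freq_dot d (k q) x)) * cnj (D q) * F q))
        \<le> W q * (H * (1 / real m) powr \<alpha> * (2 * real m) powr A / \<gamma>)"
      using W by (simp add: norm_mult)
  qed
  also have "\<dots> \<le> (2 * real m) ^ d * (H * (1 / real m) powr \<alpha> * (2 * real m) powr A / \<gamma>)"
    unfolding sum_distrib_right[symmetric] using W_sum H assms by (intro mult_right_mono) auto
  also have "\<dots> = H * (1 / real m) powr \<alpha> * ((2 * real m) powr (A + real d) / \<gamma>)"
    using assms by (simp add: powr_add powr_realpow)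
  finally have fourier: "\<bar>\<Sum>j<N. S (p j)\<bar> \<le> H * (1 / real m) powr \<alpha> * ((2 * real m) powr (A + real d) / \<gamma>)" .
  have "\<bar>(\<Sum>j<N. \<psi> (p j)) - (\<Sum>j<N. S (p j))\<bar> \<le> (\<Sum>j<N. \<bar>\<psi> (p j) - S (p j)\<bar>)"
    unfolding sum_subtractf[symmetric] by (rule sum_abs)
  also have "\<dots> \<le> (\<Sum>j<N. H * (1 / real m) powr \<alpha> * (1 + real d))"
    unfolding S_def using assms K_int K_nonneg K_total moment
    by (intro sum_mono smoothing_error) (auto simp: p_def)
  finally have "\<bar>birkhoff_sum d \<omega> \<psi> N x\<bar>
      \<le> real N * (H * (1 / real m) powr \<alpha> * (1 + real d)) + H * (1 / real m) powr \<alpha> * ((2 * real m) powr (A + real d) / \<gamma>)"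
    using fourier by (simp add: birkhoff_sum_def p_def)
  then have "1 / real N * \<bar>birkhoff_sum d \<omega> \<psi> N x\<bar> \<le> 1 / real N * (real N * (H * (1 / real m) powr \<alpha> * (1 + real d)) + H * (1 / real m) powr \<alpha> * ((2 * real m) powr (A + real d) / \<gamma>))"
    by (intro mult_left_mono) auto
  also have "\<dots> = H * (1 / real m) powr \<alpha> * (1 + real d + (2 * real m) powr (A + real d) / (\<gamma> * real N))"
    using assms by (simp add: field_simps)
  finally show ?thesis by (simp add: abs_mult)
qed

section \<open>An upper bound for the Diophantine constant\<close>

text \<open>Pigeonhole on the \<open>d + 1\<close> partial sums \<open>\<omega>\<^sub>0 + \<dots> + \<omega>\<^sub>i\<^sub>-\<^sub>1\<close>.\<close>

lemma diophantine_constant_le: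
  assumes "d \<ge> 1" and dio: "diophantine d \<gamma> A \<omega>"
  shows "\<gamma> * real d \<le> 1"
proof -
  define T where "T i = (\<Sum>l<i. \<omega> l)" for i :: nat
  define f where "f i = \<lfloor>real d * circle_frac (T i)\<rfloor>" for i
  have "f ` {..d} \<subseteq> {0..<int d}"
  proof
    fix z assume "z \<in> f ` {..d}"
    then obtain i where "z = f i" by blast
    moreover have "real d * circle_frac (T i) < real d * 1"
      using assms(1) circle_frac_bounds by (intro mult_strict_left_mono) auto
    ultimately show "z \<in> {0..<int d}"
      using circle_frac_bounds by (simp add: f_def floor_less_iff)
  qed
  then have "card (f ` {..d}) \<le> card {0..<int d}"
    by (intro card_mono) auto
  then have "\<not> inj_on f {..d}"
    by (intro pigeonhole) simp
  then obtain i j where ij: "i < j" "j \<le> d" "f i = f j"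
    by (auto simp: inj_on_def) (metis linorder_neqE_nat)
  \<comment> \<open>The indicator of the block between the two colliding partial sums. Its entries
    are 0 and 1, so \<open>freq_norm d k\<close> is 1 and the exponent \<open>A\<close> drops out of
    the Diophantine inequality.\<close>
  define k where "k l = (if i \<le> l \<and> l < j then 1 else 0 :: int)" for l
  have "freq_dot d k \<omega> = (\<Sum>l<d. if l \<in> {i..<j} then \<omega> l else 0)"
    unfolding freq_dot_def by (intro sum.cong) (auto simp: k_def circle_scale_0)
  also have "\<dots> = (\<Sum>l\<in>{i..<j}. \<omega> l)"
  proof -
    have "{..<d} \<inter> {i..<j} = {i..<j}" using ij by auto
    then show ?thesis by (simp only: sum.inter_restrict[symmetric] finite_lessThan)
  qed
  also have "\<dots> = T j - T i"
    unfolding T_def lessThan_atLeast0 using ij by (simp add: sum_diff_nat_ivl)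
  also have "\<dots> = to_circle (circle_frac (T j)) - to_circle (circle_frac (T i))" by simp
  also have "\<dots> = to_circle (circle_frac (T j) - circle_frac (T i))" by transfer simp
  finally have "circle_norm (freq_dot d k \<omega>) \<le> \<bar>circle_frac (T j) - circle_frac (T i)\<bar>"
    using circle_norm_to_circle_le by simp
  also have "\<dots> \<le> 1 / real d"
  proof -
    have "\<bar>real d * circle_frac (T j) - real d * circle_frac (T i)\<bar> \<le> 1"
      using ij(3) unfolding f_def by linarith
    then have "real d * \<bar>circle_frac (T j) - circle_frac (T i)\<bar> \<le> 1"
      by (simp add: abs_mult flip: right_diff_distrib)
    then show ?thesis using assms(1) by (simp add: field_simps)
  qed
  finally have small: "circle_norm (freq_dot d k \<omega>) \<le> 1 / real d" .
  have "k i \<noteq> 0" "i < d" using ij by (auto simp: k_def)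
  then have "0 < freq_norm d k" by (intro freq_norm_pos)
  moreover obtain l where "freq_norm d k = \<bar>k l\<bar>"
    using assms(1) by (metis freq_norm_attained)
  ultimately have "freq_norm d k = 1" by (simp add: k_def split: if_splits)
  then have "\<gamma> \<le> 1 / real d"
    using dio \<open>k i \<noteq> 0\<close> \<open>i < d\<close> small by (force simp: diophantine_def)
  then show ?thesis using assms(1) by (simp add: field_simps)
qed

section \<open>From the Hoelder norm to the final estimate\<close>

lemma holder_space_bound:
  assumes "d \<ge> 1" "\<phi> \<in> holder_space d \<alpha>"
  shows "holder_bound d \<alpha> (Sup (holder_quotients d \<alpha> \<phi>)) \<phi>"
proof -
  have bdd: "bdd_above (holder_quotients d \<alpha> \<phi>)" using assms by (simp add: holder_space_def)
  have q: "\<bar>\<phi> x - \<phi> y\<bar> / torus_dist d x y powr \<alpha> \<le> Sup (holder_quotients d \<alpha> \<phi>)"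
    if "x \<in> torus d" "y \<in> torus d" "x \<noteq> y" for x y
    using that by (intro cSup_upper bdd) (auto simp: holder_quotients_def)
  \<comment> \<open>Two distinct points, half a period apart in each coordinate. They show that the
    set of quotients is nonempty, so that its supremum is at least one nonnegative element.\<close>
  define x y where "x = (\<lambda>j\<in>{..<d}. 0 :: circle)" and "y = (\<lambda>j\<in>{..<d}. to_circle (1 / 2))"
  have "circle_norm (to_circle (1 / 2)) \<noteq> 0" by (simp add: circle_norm_to_circle round_def)
  then have "to_circle (1 / 2) \<noteq> 0" by (metis circle_norm_0)
  then have "x 0 \<noteq> y 0" using assms(1) by (simp add: x_def y_def)
  then have "x \<noteq> y" by metis
  moreover have "x \<in> torus d" "y \<in> torus d" by (auto simp: x_def y_def torus_def)
  ultimately have Sup_nonneg: "0 \<le> Sup (holder_quotients d \<alpha> \<phi>)"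
    by (intro order_trans[OF _ q[of x y]]) auto
  have "\<bar>\<phi> x - \<phi> y\<bar> \<le> Sup (holder_quotients d \<alpha> \<phi>) * torus_dist d x y powr \<alpha>"
    if "x \<in> torus d" "y \<in> torus d" for x y
    using q[OF that] torus_dist_pos[OF assms(1) that]
    by (cases "x = y") (auto simp: divide_le_eq Sup_nonneg split: if_splits)
  then show ?thesis using Sup_nonneg by (simp add: holder_bound_def)
qed

lemma sup_norm_nonneg:
  assumes "\<And>x. x \<in> torus d \<Longrightarrow> \<bar>f x\<bar> \<le> B"
  shows "0 \<le> sup_norm d f"
proof -
  obtain x where "x \<in> torus d" using torus_not_empty by blast
  then show ?thesis
    unfolding sup_norm_def using assms by (intro cSUP_upper2[where x = x] bdd_aboveI2[where M = B]) auto
qed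

theorem theorem3:
  shows "\<exists>C::real. \<forall>(d::nat) (\<alpha>::real) (\<gamma>::real) (A::real) (\<phi>::(nat \<Rightarrow> circle) \<Rightarrow> real) (\<omega>::nat \<Rightarrow> circle).
    d \<ge> 1 \<longrightarrow> 0 < \<alpha> \<longrightarrow> \<alpha> \<le> 1 \<longrightarrow> \<gamma> > 0 \<longrightarrow> A > real d \<longrightarrow>
    \<phi> \<in> holder_space d \<alpha> \<longrightarrow> \<omega> \<in> torus d \<longrightarrow> diophantine d \<gamma> A \<omega> \<longrightarrow>
    (\<forall>N\<ge>1. sup_norm d (\<lambda>x. 1 / real N * birkhoff_sum d \<omega> \<phi> N x - (\<integral>y. \<phi> y \<partial>torus_haar d))
            \<le> C / \<gamma> * holder_norm d \<alpha> \<phi> * (1 / real N powr (\<alpha> / (A + real d))))"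
\<comment> \<open>\<open>12 = 4 * 3\<close>: the factor 4 is lost in rounding the degree of the
  kernel, and 3 counts the error terms, each at most \<open>1/\<gamma>\<close>.\<close>
proof (intro exI[of _ 12] allI impI)
  fix d N :: nat and \<alpha> \<gamma> A :: real and \<phi> :: "(nat \<Rightarrow> circle) \<Rightarrow> real" and \<omega> :: "nat \<Rightarrow> circle"
  assume d: "d \<ge> 1" and \<alpha>: "0 < \<alpha>" "\<alpha> \<le> 1" and \<gamma>: "\<gamma> > 0" and A: "A > real d"
    and \<phi>: "\<phi> \<in> holder_space d \<alpha>" and dio: "diophantine d \<gamma> A \<omega>" and N: "N \<ge> 1"
  define H where "H = Sup (holder_quotients d \<alpha> \<phi>)"
  define \<psi> where "\<psi> x = \<phi> x - (\<integral>y. \<phi> y \<partial>torus_haar d)" for x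
  \<comment> \<open>The scale with \<open>t^(A+d) = N\<close>; the rate to be shown is then
    \<open>t^-\<alpha>\<close>.\<close>
  define t where "t = real N powr (1 / (A + real d))"
  have H: "holder_bound d \<alpha> H \<phi>"
    unfolding H_def by (rule holder_space_bound) fact+
  then have H0: "0 \<le> H" by (simp add: holder_bound_def)
  have \<psi>: "holder_bound d \<alpha> H \<psi>"
    using H by (simp add: holder_bound_def \<psi>_def)
  obtain B where B: "\<And>x. x \<in> torus d \<Longrightarrow> \<bar>\<phi> x\<bar> \<le> B"
    using d \<alpha> H by (metis holder_bound_bounded)
  then have H_le: "H \<le> holder_norm d \<alpha> \<phi>"
    unfolding holder_norm_def H_def using sup_norm_nonneg[of d \<phi> B] by simp
  have \<phi>_int: "integrable (torus_haar d) \<phi>"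
    using measurable_holder_bound[OF d \<alpha>(1) H] B by (intro integrable_torus_bounded[where B = B]) auto
  then have mean: "(\<integral>y. \<psi> y \<partial>torus_haar d) = 0"
    unfolding \<psi>_def by (simp add: Bochner_Integration.integral_diff torus_haar.prob_space)
  have birkhoff: "1 / real N * birkhoff_sum d \<omega> \<psi> N x
      = 1 / real N * birkhoff_sum d \<omega> \<phi> N x - (\<integral>y. \<phi> y \<partial>torus_haar d)" for x
    using N by (simp add: birkhoff_sum_def \<psi>_def sum_subtractf field_simps)
  have \<gamma>d: "\<gamma> * real d \<le> 1" using d dio by (rule diophantine_constant_le)
  have "\<gamma> * 1 \<le> \<gamma> * real d" using \<gamma> d by (intro mult_left_mono) auto
  then have \<gamma>1: "\<gamma> \<le> 1" using \<gamma>d by linarith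
  have t1: "1 \<le> t" unfolding t_def using N A by (intro ge_one_powr_ge_zero) auto
  have t_\<alpha>: "real N powr (\<alpha> / (A + real d)) = t powr \<alpha>"
    by (simp add: t_def powr_powr)
  have t_N: "t powr (A + real d) = real N"
    using A N by (simp add: t_def powr_powr)
  have bound: "\<bar>1 / real N * birkhoff_sum d \<omega> \<psi> N x\<bar> \<le> 12 / \<gamma> * H * (1 / t powr \<alpha>)" if x: "x \<in> torus d" for x
  \<comment> \<open>Below 2 no degree \<open>m \<ge> 1\<close> satisfies \<open>2 m \<le> t\<close>.
    There the oscillation bound \<open>H\<close> is enough, because \<open>\<gamma> \<le> 1\<close>
    and \<open>t^\<alpha> \<le> 2\<close>.\<close>
  proof (cases "t < 2")
    case True
    have "\<bar>\<psi> z\<bar> \<le> H" if z: "z \<in> torus d" for z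
    proof -
      have "\<psi> z = (\<integral>y. \<psi> z - \<psi> y \<partial>torus_haar d)"
        using mean \<phi>_int by (simp add: \<psi>_def Bochner_Integration.integral_diff torus_haar.prob_space)
      also have "norm \<dots> \<le> H"
        using \<psi> d \<alpha> z H0 by (intro norm_torus_integral_le) (auto intro: holder_bound_oscillation)
      finally show ?thesis by simp
    qed
    then have "\<bar>birkhoff_sum d \<omega> \<psi> N x\<bar> \<le> (\<Sum>j<N. H)"
      unfolding birkhoff_sum_def by (intro order_trans[OF sum_abs] sum_mono) simp
    then have "\<bar>1 / real N * birkhoff_sum d \<omega> \<psi> N x\<bar> \<le> H"
      using N by (simp add: abs_mult field_simps)
    also have "H \<le> 12 / \<gamma> * H * (1 / t powr \<alpha>)"
    proof -
      have "t powr \<alpha> \<le> t powr 1" using t1 \<alpha> by (intro powr_mono) auto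
      then have "\<gamma> * t powr \<alpha> \<le> 1 * 2" using \<gamma>1 \<gamma> t1 True by (intro mult_mono) auto
      then have "H * (\<gamma> * t powr \<alpha>) \<le> H * 12" using H0 by (intro mult_left_mono) auto
      then show ?thesis using \<gamma> t1 by (simp add: field_simps)
    qed
    finally show ?thesis .
  next
    case False
    \<comment> \<open>The largest integer with \<open>2 m \<le> t\<close>. Since
      \<open>t/2 < m + 1 \<le> 2 m\<close>, rounding costs at most a factor 4.\<close>
    define m where "m = nat \<lfloor>t / 2\<rfloor>"
    have "1 \<le> \<lfloor>t / 2\<rfloor>" using False by (simp add: le_floor_iff)
    then have m: "m > 0" "real m = of_int \<lfloor>t / 2\<rfloor>" by (auto simp: m_def)
    have m_upper: "2 * real m \<le> t" unfolding m(2) by linarith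
    have m_lower: "t \<le> 4 * real m" using m(1) unfolding m(2) using \<open>1 \<le> \<lfloor>t / 2\<rfloor>\<close> by linarith
    have "1 / real m \<le> 4 / t"
      using m(1) m_lower t1 by (simp add: field_simps)
    then have "(1 / real m) powr \<alpha> \<le> (4 / t) powr \<alpha>"
      using \<alpha> by (intro powr_mono2) auto
    also have "\<dots> = 4 powr \<alpha> * (1 / t powr \<alpha>)"
      using t1 by (simp add: powr_divide)
    also have "\<dots> \<le> 4 powr 1 * (1 / t powr \<alpha>)"
      using \<alpha> by (intro mult_right_mono powr_mono) auto
    finally have m_powr: "(1 / real m) powr \<alpha> \<le> 4 * (1 / t powr \<alpha>)" by simp
    have "(2 * real m) powr (A + real d) \<le> real N"
      unfolding t_N[symmetric] using m_upper A by (intro powr_mono2) auto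
    then have "(2 * real m) powr (A + real d) / (\<gamma> * real N) \<le> 1 / \<gamma>"
      using \<gamma> N by (simp add: field_simps)
    \<comment> \<open>This is where the dimension disappears: \<open>1\<close>, \<open>d\<close> and
      the oscillating term are all at most \<open>1/\<gamma>\<close>.\<close>
    moreover have "1 \<le> 1 / \<gamma>" "real d \<le> 1 / \<gamma>"
      using \<gamma> \<gamma>1 \<gamma>d by (simp_all add: field_simps)
    ultimately have three: "1 + real d + (2 * real m) powr (A + real d) / (\<gamma> * real N) \<le> 3 / \<gamma>"
      by simp
    have "\<bar>1 / real N * birkhoff_sum d \<omega> \<psi> N x\<bar>
        \<le> H * (1 / real m) powr \<alpha> * (1 + real d + (2 * real m) powr (A + real d) / (\<gamma> * real N))"
      using d \<alpha> \<gamma> A m N \<psi> mean dio x by (intro birkhoff_kernel_estimate) auto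
    also have "\<dots> \<le> H * (4 * (1 / t powr \<alpha>)) * (3 / \<gamma>)"
      using three m_powr H0 \<gamma> by (intro mult_mono mult_nonneg_nonneg add_nonneg_nonneg) auto
    finally show ?thesis by (simp add: mult_ac)
  qed
  have "sup_norm d (\<lambda>x. 1 / real N * birkhoff_sum d \<omega> \<phi> N x - (\<integral>y. \<phi> y \<partial>torus_haar d))
      \<le> 12 / \<gamma> * H * (1 / t powr \<alpha>)"
    unfolding sup_norm_def birkhoff[symmetric] using bound torus_not_empty by (intro cSUP_least) auto
  also have "\<dots> \<le> 12 / \<gamma> * holder_norm d \<alpha> \<phi> * (1 / t powr \<alpha>)"
    using H_le \<gamma> by (intro mult_right_mono mult_left_mono) auto
  finally show "sup_norm d (\<lambda>x. 1 / real N * birkhoff_sum d \<omega> \<phi> N x - (\<integral>y. \<phi> y \<partial>torus_haar d))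
      \<le> 12 / \<gamma> * holder_norm d \<alpha> \<phi> * (1 / real N powr (\<alpha> / (A + real d)))"
    unfolding t_\<alpha> .
qed

end
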